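(* The only critical points for the area among Reuleaux polygons are the regular ones: if $R$ is a Reuleaux polygon with $n=2k+1\ge5$ vertices which is a critical point for the area, then $R$ is a regular Reuleaux $n$-gon.
   Context: All constant width shapes have unit width. $B(c)$ denotes the closed disk of radius $1$ centered at $c\in\mathbb{R}^2$. A Reuleaux polygon is a planar constant width shape that is the intersection of finitely many unit disks with pairwise distinct centers; the minimal number $n\ge3$ of disks involved is its number of sides and vertices. This number is odd, $n=2k+1$, and the centers of the $n$ disks are exactly the vertices (angular points of the boundary). The regular Reuleaux $n$-gon is the intersection of the unit disks centered at the vertices of a regular $n$-gon of unit diameter. Perturbation of a vertex ($n\ge5$): label the vertices $x_0,\dots,x_{n-1}$ counter-clockwise, indices modulo $n$. The arc of $\partial R$ centered at $x_i$ has endpoints $x_{i+k},x_{i+k+1}$. Given an index $i$, a unit vector $v\in\mathbb{R}^2$ and $t$ near $0$, let $x_{i+k}(t)$ be the intersection point of $\partial B(x_i+tv)$ and $\partial B(x_{i-1})$ depending continuously on $t$ with $x_{i+k}(0)=x_{i+k}$, and let $x_{i+k+1}(t)$ be the intersection point of $\partial B(x_i+tv)$ and $\partial B(x_{i+1})$ depending continuously on $t$ with $x_{i+k+1}(0)=x_{i+k+1}$. Let $R_{i,v}(t)$ be the intersection of the unit disks centered at $x_i+tv$, $x_{i+k}(t)$, $x_{i+k+1}(t)$ and the remaining (fixed) vertices; it is a Reuleaux $n$-gon for $t$ small. $R$ is called a critical point for the area if $\frac{d}{dt}\operatorname{Area}(R_{i,v}(t))|_{t=0}=0$ for every $i\in\{0,\dots,n-1\}$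 and every unit vector $v$. *)

theory Defs
  imports "HOL-Analysis.Analysis"
begin

definition constant_width :: "(real^2) set \<Rightarrow> bool" where
  "constant_width K \<longleftrightarrow> compact K \<and> convex K \<and> K \<noteq> {} \<and>
     (\<forall>u. norm u = 1 \<longrightarrow> (SUP p\<in>K. u \<bullet> p) - (INF p\<in>K. u \<bullet> p) = 1)"

definition disk_intersection :: "(real^2) set \<Rightarrow> (real^2) set" where
  "disk_intersection C = (\<Inter>c\<in>C. cball c 1)"

definition reuleaux_polygon :: "(real^2) set \<Rightarrow> bool" where
  "reuleaux_polygon R \<longleftrightarrow> constant_width R \<and> (\<exists>C. finite C \<and> R = disk_intersection C)"

definition num_sides :: "(real^2) set \<Rightarrow> nat" where
  "num_sides R = (LEAST m. \<exists>C. finite C \<and> card C = m \<and> R = disk_intersection C)"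

definition unit_outer_normal :: "(real^2) set \<Rightarrow> real^2 \<Rightarrow> real^2 \<Rightarrow> bool" where
  "unit_outer_normal K p u \<longleftrightarrow> norm u = 1 \<and> (\<forall>q\<in>K. u \<bullet> q \<le> u \<bullet> p)"

text \<open>The vertices are the angular points of the boundary: those with more than one
  supporting line.\<close>

definition vertices :: "(real^2) set \<Rightarrow> (real^2) set" where
  "vertices K = {p \<in> frontier K.
     \<exists>u w. unit_outer_normal K p u \<and> unit_outer_normal K p w \<and> u \<noteq> w}"

definition orient :: "real^2 \<Rightarrow> real^2 \<Rightarrow> real^2 \<Rightarrow> real" where
  "orient a b c = (b - a)$1 * (c - a)$2 - (b - a)$2 * (c - a)$1"

text \<open>The vertices of a Reuleaux polygon are in strictly convex position, so they are listed
  counter-clockwise iff every triple taken in the order of the list is positively oriented.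
  Indices are modulo the number of sides; only \<open>x 0, \<dots>, x (num_sides R - 1)\<close> matter.\<close>

definition ccw_labelling :: "(real^2) set \<Rightarrow> (nat \<Rightarrow> real^2) \<Rightarrow> bool" where
  "ccw_labelling R x \<longleftrightarrow> bij_betw x {..<num_sides R} (vertices R) \<and>
     (\<forall>i j l. i < j \<and> j < l \<and> l < num_sides R \<longrightarrow> orient (x i) (x j) (x l) > 0)"

text \<open>\<open>y t\<close> is an intersection point of the unit circles centred at \<open>a + t v\<close> and \<open>b\<close>
  that depends continuously on \<open>t\<close> near \<open>0\<close> and equals \<open>y0\<close> at \<open>t = 0\<close>.\<close>

definition intersection_branch ::
    "real^2 \<Rightarrow> real^2 \<Rightarrow> real^2 \<Rightarrow> real^2 \<Rightarrow> (real \<Rightarrow> real^2) \<Rightarrow> bool" where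
  "intersection_branch a v b y0 y \<longleftrightarrow> y 0 = y0 \<and>
     (\<exists>e>0. continuous_on {-e<..<e} y \<and>
        (\<forall>t\<in>{-e<..<e}. y t \<in> sphere (a + t *\<^sub>R v) 1 \<inter> sphere b 1))"

text \<open>With \<open>n = 2 k + 1\<close>, the vertices \<open>x i\<close>, \<open>x (i + k)\<close>, \<open>x (i + k + 1)\<close> are moved to
  \<open>x i + t v\<close>, \<open>y t\<close>, \<open>z t\<close>.\<close>

definition perturbation ::
    "nat \<Rightarrow> (nat \<Rightarrow> real^2) \<Rightarrow> nat \<Rightarrow> real^2 \<Rightarrow> (real \<Rightarrow> real^2) \<Rightarrow> (real \<Rightarrow> real^2)
      \<Rightarrow> real \<Rightarrow> (real^2) set" where
  "perturbation k x i v y z t = (let n = 2 * k + 1 in disk_intersection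
     ((x(i := x i + t *\<^sub>R v, (i + k) mod n := y t, (i + k + 1) mod n := z t)) ` {..<n}))"

text \<open>Counter-clockwise labellings differ only by a cyclic shift, and the two branches are
  unique near \<open>t = 0\<close>, so the choice of the quantifiers over \<open>x\<close>, \<open>y\<close>, \<open>z\<close> is immaterial.\<close>

definition area_critical :: "(real^2) set \<Rightarrow> bool" where
  "area_critical R \<longleftrightarrow> (\<exists>k x. num_sides R = 2 * k + 1 \<and> ccw_labelling R x \<and>
     (\<forall>i<num_sides R. \<forall>v. norm v = 1 \<longrightarrow> (\<forall>y z.
        let n = num_sides R in
        intersection_branch (x i) v (x ((i + n - 1) mod n)) (x ((i + k) mod n)) y \<and>
        intersection_branch (x i) v (x ((i + 1) mod n)) (x ((i + k + 1) mod n)) z \<longrightarrow>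
        ((\<lambda>t. measure lebesgue (perturbation k x i v y z t)) has_real_derivative 0) (at 0))))"

definition regular_ngon_vertices :: "nat \<Rightarrow> real^2 \<Rightarrow> real \<Rightarrow> real \<Rightarrow> (real^2) set" where
  "regular_ngon_vertices n c r \<theta> =
     (\<lambda>j. c + r *\<^sub>R vector [cos (\<theta> + 2 * pi * real j / real n),
                          sin (\<theta> + 2 * pi * real j / real n)]) ` {..<n}"

definition regular_reuleaux_polygon :: "nat \<Rightarrow> (real^2) set \<Rightarrow> bool" where
  "regular_reuleaux_polygon n R \<longleftrightarrow> (\<exists>c r \<theta>. r > 0 \<and>
     diameter (convex hull (regular_ngon_vertices n c r \<theta>)) = 1 \<and>
     R = disk_intersection (regular_ngon_vertices n c r \<theta>))"

end

theory Submission
  imports Defs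
begin

text \<open>Let \<open>x\<^sub>j\<close> be the vertices and \<open>\<alpha>\<^sub>j\<close> the angle at \<open>x\<^sub>j\<close> of the arc centred at \<open>x\<^sub>j\<close>. Cutting the
  polygon along the chords of its arcs gives an inner polygon and one cap per arc. When the
  centres move, the chords are kept in place: the new body is covered by the old inner polygon
  and the caps cut from the moved disks by the old chords. This bound on the area is sharp at
  time \<open>0\<close>, so its derivative equals that of the area, and it involves only the area of
  a circular segment as a function of its height. Hence the area has derivative
  \<open>\<Sum>\<^sub>j x\<^sub>j' \<times> (x\<^bsub>j+k+1\<^esub> - x\<^bsub>j+k\<^esub>)\<close>. For a perturbation moving \<open>x\<^sub>i\<close> orthogonally to
  \<open>x\<^bsub>i+k+1\<^esub> - x\<^sub>i\<close>, it vanishes only if \<open>tan (\<alpha>\<^sub>i / 2) = tan (\<alpha>\<^bsub>i+k\<^esub> / 2)\<close>. So all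
  angles agree, and the star polygon \<open>x\<^sub>0, x\<^sub>k, x\<^bsub>2k\<^esub>, \<dots>\<close> has unit sides and a constant turning angle.\<close>

subsection \<open>Plane geometry\<close>

text \<open>The definitions mention only constant width, finitely many disks and angular points, so
  the arcs and their ends must be recovered. The tool is that a unit outer normal \<open>u\<close>
  at a point \<open>q\<close> of the body forces \<open>q - u\<close> into the body. It shows that
  the angular points are the centres and that each is an end of at least two diameters; as diameters
  without a common end must cross, the ones at a vertex lead exactly to the vertices
  \<open>k\<close> and \<open>k + 1\<close> steps further. Fixed chords spare any description of the
  perturbed body: the upper bound holds for every choice of \<open>n\<close> centres, and overlaps
  only increase it. The area of a segment is convex in the distance of its chord from the centre, so
  a tangent inequality, proved with rectangles, replaces integration. Differentiability of the area
  is part of criticality. The chosen direction is special because the other dependent vertex then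
  has velocity zero, leaving two angles to compare. Finally \<open>k\<close> is invertible modulo
  \<open>2 * k + 1\<close>, with inverse \<open>n - 2\<close>, so the star polygon visits every
  vertex.\<close>

definition perp :: "real^2 \<Rightarrow> real^2" where
  "perp a = vector [- a$2, a$1]"

definition cross :: "real^2 \<Rightarrow> real^2 \<Rightarrow> real" where
  "cross a b = a$1 * b$2 - a$2 * b$1"

lemma perp_nth [simp]: "perp a $ 1 = - a$2" "perp a $ 2 = a$1"
  by (simp_all add: perp_def)

lemma inner_2: "a \<bullet> b = a$1 * b$1 + a$2 * b$2" for a b :: "real^2"
  by (simp add: inner_vec_def sum_2)

lemma vec_eq_2: "a = b \<longleftrightarrow> a$1 = b$1 \<and> a$2 = b$2" for a b :: "real^2"
  by (simp add: vec_eq_iff forall_2)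

lemma orient_eq_cross: "orient a b c = cross (b - a) (c - a)"
  by (simp add: orient_def cross_def)

lemma orient_rotate: "orient b c a = orient a b c"
  by (simp add: orient_def algebra_simps)

lemma norm_perp [simp]: "norm (perp a) = norm a"
  by (simp add: norm_eq_sqrt_inner inner_2)

lemma expand_by_inner_perp:
  assumes "norm e = 1"
  shows "d = (d \<bullet> e) *\<^sub>R e + (d \<bullet> perp e) *\<^sub>R perp e"
proof -
  have 1: "e$1 * e$1 + e$2 * e$2 = 1"
    using assms by (simp add: norm_eq_1 inner_2)
  have "d$1 * (e$1 * e$1 + e$2 * e$2) = d$1" "d$2 * (e$1 * e$1 + e$2 * e$2) = d$2"
    unfolding 1 by simp_all
  then show ?thesis
    by (simp add: vec_eq_2 inner_2 algebra_simps)
qed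

lemma dist_le_1_iff:
  fixes p q u :: "'a::real_inner"
  assumes "norm u = 1"
  shows "dist (q + u) p \<le> 1 \<longleftrightarrow> (p - q) \<bullet> (p - q) \<le> 2 * (u \<bullet> (p - q))"
proof -
  have "u \<bullet> u = 1" using assms by (simp add: norm_eq_1)
  have "dist (q + u) p \<le> 1 \<longleftrightarrow> (q + u - p) \<bullet> (q + u - p) \<le> 1"
    by (simp add: dist_norm norm_le_square power2_eq_square dot_square_norm abs_square_le_1)
  also have "(q + u - p) \<bullet> (q + u - p) = 1 + (p - q) \<bullet> (p - q) - 2 * (u \<bullet> (p - q))"
    using \<open>u \<bullet> u = 1\<close> by (simp add: inner_diff_left inner_diff_right inner_add_left inner_add_right inner_commute)
  finally show ?thesis by simp
qed

text \<open>Each distance bound reads \<open>1 - w \<bullet> r \<le> u \<bullet> (w - r)\<close>.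
  Adding them with weights \<open>a\<close> and \<open>b\<close> gives
  \<open>(a + b - 1) * (u \<bullet> w - 1) \<ge> 0\<close>, so the unit vectors \<open>u\<close> and
  \<open>w\<close> coincide. This later shows that a point strictly inside an arc has only one
  normal.\<close>

lemma unit_combination_eq:
  fixes p q w u :: "'a::real_inner"
  assumes "norm p = 1" "norm q = 1" "norm w = 1" "norm u = 1"
    and w: "w = a *\<^sub>R p + b *\<^sub>R q" "a \<ge> 0" "b \<ge> 0" "a + b > 1"
    and "dist (w - u) p \<le> 1" "dist (w - u) q \<le> 1"
  shows "u = w"
proof -
  have *: "1 - w \<bullet> r \<le> u \<bullet> (w - r)" if "norm r = 1" "dist (w - u) r \<le> 1" for r
    using dist_le_1_iff[of "- u" w r] that assms(3,4)
    by (simp add: norm_eq_1 inner_diff_left inner_diff_right inner_commute)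
  have "a * (1 - w \<bullet> p) + b * (1 - w \<bullet> q) \<le> a * (u \<bullet> (w - p)) + b * (u \<bullet> (w - q))"
    by (intro add_mono mult_left_mono * assms)
  moreover have "a * (w \<bullet> p) + b * (w \<bullet> q) = 1"
    using assms(3) unfolding norm_eq_1 by (subst (asm) (2) w(1)) (simp add: inner_add_right)
  moreover have "a * (u \<bullet> p) + b * (u \<bullet> q) = u \<bullet> w"
    by (subst w(1)) (simp add: inner_add_right)
  ultimately have "(a + b - 1) * 1 \<le> (a + b - 1) * (u \<bullet> w)"
    by (simp add: algebra_simps inner_diff_right)
  then have "u \<bullet> w \<ge> 1"
    using w(4) by (subst (asm) mult_le_cancel_left_pos) auto
  then have "(u - w) \<bullet> (u - w) \<le> 0"
    using assms(3,4) by (simp add: norm_eq_1 inner_diff_left inner_diff_right inner_commute)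
  then show ?thesis by (metis inner_gt_zero_iff not_less eq_iff_diff_eq_0)
qed

text \<open>The component of \<open>q - b\<close> along \<open>w\<close> is half of \<open>w\<close>
  by symmetry, and the unit length then fixes the orthogonal component up to sign. The explicit form
  matters: with the sign frozen it also yields a differentiable branch when a centre moves.\<close>

lemma two_circles_point:
  fixes q a b :: "real^2"
  assumes "dist q a = 1" "dist q b = 1" "a \<noteq> b"
  defines "w \<equiv> a - b"
  defines "s \<equiv> sqrt (1 / (w \<bullet> w) - 1 / 4)"
  shows "\<exists>\<sigma>\<in>{1, - 1}. q = b + (1/2) *\<^sub>R w + (\<sigma> * s) *\<^sub>R perp w"
proof -
  have ww: "w \<bullet> w > 0" using assms(3) by (simp add: w_def)
  define d where "d = q - b"
  have d1: "d \<bullet> d = 1"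
    using assms(2) by (simp add: d_def dist_norm norm_eq_1)
  have d2: "d \<bullet> w = (w \<bullet> w) / 2"
  proof -
    have "(d - w) \<bullet> (d - w) = 1" using assms(1) by (simp add: d_def w_def dist_norm norm_eq_1)
    then show ?thesis using d1 by (simp add: inner_diff_left inner_diff_right inner_commute)
  qed
  define c where "c = (d \<bullet> perp w) / (w \<bullet> w)"
  have eqd: "d = (1/2) *\<^sub>R w + c *\<^sub>R perp w"
  proof -
    have "(w \<bullet> w) *\<^sub>R d = (d \<bullet> w) *\<^sub>R w + (d \<bullet> perp w) *\<^sub>R perp w"
      by (simp add: vec_eq_2 inner_2 algebra_simps)
    also have "\<dots> = (w \<bullet> w) *\<^sub>R ((1/2) *\<^sub>R w + c *\<^sub>R perp w)"
      using ww by (simp add: d2 c_def scaleR_add_right)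
    finally show ?thesis using ww by (metis less_irrefl scaleR_left_imp_eq)
  qed
  have "d \<bullet> d = (w \<bullet> w) * (1/4 + c\<^sup>2)"
    by (subst (1 2) eqd) (simp add: inner_2 power2_eq_square algebra_simps)
  then have c2: "c\<^sup>2 = 1 / (w \<bullet> w) - 1/4" using ww d1 by (simp add: field_simps)
  have "s = \<bar>c\<bar>" unfolding s_def c2[symmetric] by simp
  then have "c = 1 * s \<or> c = - 1 * s" by auto
  then show "\<exists>\<sigma>\<in>{1, - 1}. q = b + (1/2) *\<^sub>R w + (\<sigma> * s) *\<^sub>R perp w"
    using eqd by (auto simp: d_def algebra_simps)
qed

lemma finite_sphere_Int_sphere:
  fixes a b :: "real^2"
  assumes "a \<noteq> b"
  shows "finite (sphere a 1 \<inter> sphere b 1)"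
proof (rule finite_subset)
  let ?w = "a - b"
  let ?s = "sqrt (1 / (?w \<bullet> ?w) - 1 / 4)"
  show "sphere a 1 \<inter> sphere b 1 \<subseteq> (\<lambda>\<sigma>. b + (1/2) *\<^sub>R ?w + (\<sigma> * ?s) *\<^sub>R perp ?w) ` {1, - 1}"
    using two_circles_point[of _ a b] assms by (fastforce simp: dist_commute)
qed auto

lemma dist_convex_less_1:
  fixes p q c :: "'a::euclidean_space"
  assumes "p \<noteq> q" "dist p c \<le> 1" "dist q c \<le> 1" "z \<in> open_segment p q"
  shows "dist z c < 1"
  using dist_decreases_open_segment[OF assms(4), of c] assms by (auto simp: dist_commute)

lemma disk_intersection_iff: "p \<in> disk_intersection C \<longleftrightarrow> (\<forall>c\<in>C. dist p c \<le> 1)"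
  by (auto simp: disk_intersection_def dist_commute)

lemma closed_disk_intersection: "closed (disk_intersection C)"
  by (auto simp: disk_intersection_def)

lemma convex_disk_intersection: "convex (disk_intersection C)"
  unfolding disk_intersection_def by (rule convex_INT) auto

subsection \<open>Sets of constant width\<close>

lemma constant_width_opposite:
  assumes "constant_width K" "q \<in> K" "unit_outer_normal K q u"
  shows "\<exists>p\<in>K. u \<bullet> p = u \<bullet> q - 1"
proof -
  have K: "compact K" "K \<noteq> {}" and u: "norm u = 1" and m: "\<And>p. p \<in> K \<Longrightarrow> u \<bullet> p \<le> u \<bullet> q"
    using assms by (auto simp: constant_width_def unit_outer_normal_def)
  have "continuous_on K (\<lambda>p. u \<bullet> p)" by (intro continuous_intros)
  then obtain p where p: "p \<in> K" "\<And>r. r \<in> K \<Longrightarrow> u \<bullet> p \<le> u \<bullet> r"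
    using continuous_attains_inf[OF K] by blast
  have "(SUP p\<in>K. u \<bullet> p) = u \<bullet> q"
    using assms(2) m by (intro cSup_eq_maximum) auto
  moreover have "(INF p\<in>K. u \<bullet> p) = u \<bullet> p"
    using p by (intro cInf_eq_minimum) auto
  ultimately show ?thesis
    using assms(1) u p(1) by (force simp: constant_width_def)
qed

lemma constant_width_dist_le:
  assumes "constant_width K" "p \<in> K" "q \<in> K"
  shows "dist p q \<le> 1"
proof (cases "p = q")
  case False
  define u where "u = (p - q) /\<^sub>R norm (p - q)"
  have u: "norm u = 1" using False by (simp add: u_def)
  have bd: "bounded ((\<lambda>p. u \<bullet> p) ` K)"
    using assms(1)
    by (intro bounded_linear_image bounded_linear_inner_right compact_imp_bounded) (simp add: constant_width_def)
  have "u \<bullet> p \<le> (SUP p\<in>K. u \<bullet> p)"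
    using assms(2) bd by (auto intro!: cSUP_upper bounded_imp_bdd_above)
  moreover have "(INF p\<in>K. u \<bullet> p) \<le> u \<bullet> q"
    using assms(3) bd by (auto intro!: cINF_lower bounded_imp_bdd_below)
  moreover have "u \<bullet> p - u \<bullet> q = dist p q"
  proof -
    have "u \<bullet> p - u \<bullet> q = inverse (norm (p - q)) * (norm (p - q))\<^sup>2"
      by (simp add: u_def power2_norm_eq_inner inner_diff_right right_diff_distrib)
    then show ?thesis using False by (simp add: dist_norm power2_eq_square)
  qed
  ultimately show ?thesis
    using assms(1) u by (force simp: constant_width_def)
qed auto

text \<open>The opposite point \<open>p\<close> satisfies \<open>u \<bullet> (q - p) = 1\<close>
  although \<open>q - p\<close> has length at most 1; equality in Cauchy-Schwarz gives
  \<open>q - p = u\<close>. Normals at a point thus turn into diameters ending there.\<close>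

lemma constant_width_minus_normal:
  assumes "constant_width K" "q \<in> K" "unit_outer_normal K q u"
  shows "q - u \<in> K"
proof -
  obtain p where p: "p \<in> K" "u \<bullet> p = u \<bullet> q - 1"
    using constant_width_opposite[OF assms] by auto
  have u: "norm u = 1" using assms(3) by (simp add: unit_outer_normal_def)
  have "dist q p \<le> 1" using constant_width_dist_le[OF assms(1,2) p(1)] .
  then have "(q - p) \<bullet> (q - p) \<le> 1"
    by (simp add: dist_norm norm_le_square power2_eq_square dot_square_norm abs_square_le_1)
  then have "(q - p - u) \<bullet> (q - p - u) \<le> 0"
    using p(2) u by (simp add: norm_eq_1 inner_diff_left inner_diff_right inner_commute)
  then have "q - p - u = 0" by (metis inner_gt_zero_iff not_less)
  then have "q - u = p" by (simp add: algebra_simps)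
  then show ?thesis using p(1) by simp
qed

lemma unit_outer_normal_diff:
  assumes "\<And>z. z \<in> K \<Longrightarrow> dist z c \<le> 1" "dist q c = 1"
  shows "unit_outer_normal K q (q - c)"
  unfolding unit_outer_normal_def
proof (intro conjI ballI)
  show n: "norm (q - c) = 1" using assms(2) by (simp add: dist_norm)
  fix z assume "z \<in> K"
  have "(q - c) \<bullet> (z - c) \<le> norm (q - c) * norm (z - c)" by (rule norm_cauchy_schwarz)
  also have "\<dots> \<le> 1" using assms(1)[OF \<open>z \<in> K\<close>] n by (simp add: dist_norm)
  also have "\<dots> = (q - c) \<bullet> (q - c)" using n by (simp add: norm_eq_1)
  finally show "(q - c) \<bullet> z \<le> (q - c) \<bullet> q" by (simp add: inner_diff_right)
qed

lemma unit_outer_normal_frontier: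
  assumes "q \<in> K" "unit_outer_normal K q u"
  shows "q \<in> frontier K"
proof -
  have "q \<notin> interior K"
  proof
    assume "q \<in> interior K"
    then obtain e where e: "e > 0" "cball q e \<subseteq> K" by (auto simp: mem_interior_cball)
    have u: "norm u = 1" "\<forall>z\<in>K. u \<bullet> z \<le> u \<bullet> q" using assms(2) by (auto simp: unit_outer_normal_def)
    have "q + e *\<^sub>R u \<in> K" using e u by (auto simp: dist_norm subset_iff)
    then have "u \<bullet> (q + e *\<^sub>R u) \<le> u \<bullet> q" using u by blast
    then show False using e u by (simp add: inner_add_right norm_eq_1)
  qed
  then show ?thesis using assms(1) closure_subset by (auto simp: frontier_def)
qed

lemma unit_outer_normal_combination:
  assumes "unit_outer_normal K q u" "unit_outer_normal K q w" "a \<ge> 0" "b \<ge> 0"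
    and "norm (a *\<^sub>R u + b *\<^sub>R w) = 1"
  shows "unit_outer_normal K q (a *\<^sub>R u + b *\<^sub>R w)"
  using assms by (auto simp: unit_outer_normal_def inner_add_left intro!: add_mono mult_left_mono)

lemma frontier_disk_intersection:
  assumes "finite C" "q \<in> frontier (disk_intersection C)"
  shows "\<exists>c\<in>C. dist q c = 1"
proof (rule ccontr)
  assume *: "\<not> ?thesis"
  have q: "q \<in> disk_intersection C"
    using assms(2) closed_disk_intersection by (metis frontier_subset_closed subsetD)
  have "q \<in> (\<Inter>c\<in>C. ball c 1)"
    using q * by (force simp: disk_intersection_iff dist_commute)
  moreover have "open (\<Inter>c\<in>C. ball c 1)" using assms(1) by auto
  moreover have "(\<Inter>c\<in>C. ball c 1) \<subseteq> disk_intersection C"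
    by (auto simp: disk_intersection_def less_imp_le)
  ultimately have "q \<in> interior (disk_intersection C)" by (meson interior_maximal subsetD)
  then show False using assms(2) by (auto simp: frontier_def)
qed

subsection \<open>The vertices of a Reuleaux polygon are its centres\<close>

lemma constant_width_two_points:
  assumes "constant_width K"
  obtains p q where "p \<in> K" "q \<in> K" "p \<noteq> q"
proof -
  define u :: "real^2" where "u = axis 1 1"
  obtain p where p: "p \<in> K" using assms by (auto simp: constant_width_def)
  have "\<not> K \<subseteq> {p}"
  proof
    assume "K \<subseteq> {p}"
    then have "K = {p}" using p by auto
    moreover have "norm u = 1" by (simp add: u_def)
    ultimately show False using assms by (auto simp: constant_width_def)
  qed
  then show ?thesis using p that by blast
qed

lemma vertices_subset: "closed K \<Longrightarrow> vertices K \<subseteq> K"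
  using frontier_subset_closed by (fastforce simp: vertices_def)

lemma verticesI:
  assumes "q \<in> K" "unit_outer_normal K q u" "unit_outer_normal K q w" "u \<noteq> w"
  shows "q \<in> vertices K"
  using assms unit_outer_normal_frontier[OF assms(1,2)] unfolding vertices_def by blast

text \<open>Since the disk about \<open>c\<close> cannot be omitted, some point of its circle lies
  strictly inside all other disks, and so a piece of that circle belongs to \<open>R\<close>. Two of
  its points give two different normals at \<open>c\<close>.\<close>

lemma finite_centres_subset_vertices:
  assumes "constant_width R" "finite C" "R = disk_intersection C"
    and min: "\<And>c. c \<in> C \<Longrightarrow> R \<noteq> disk_intersection (C - {c})"
  shows "C \<subseteq> vertices R"
proof
  fix c assume c: "c \<in> C"
  have "R \<subseteq> disk_intersection (C - {c})" using assms(3) by (auto simp: disk_intersection_iff)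
  then obtain p where p: "p \<notin> R" "p \<in> disk_intersection (C - {c})" using min[OF c] by blast
  then have pc: "dist p c > 1" and pd: "\<And>d. d \<in> C \<Longrightarrow> d \<noteq> c \<Longrightarrow> dist p d \<le> 1"
    using assms(3) by (force simp: disk_intersection_iff)+
  obtain a b where ab: "a \<in> R" "b \<in> R" "a \<noteq> b" using constant_width_two_points[OF assms(1)] .
  \<comment> \<open>Strict convexity of disks puts the midpoint of two distinct points of
    \<open>R\<close> strictly inside every disk, so the segment from \<open>z\<close> to
    \<open>p\<close> leaves the disk about \<open>c\<close> at a point still interior to the
    others.\<close>
  define z where "z = midpoint a b"
  have zR: "z \<in> R"
    using closed_segment_subset[OF ab(1,2)] convex_disk_intersection[of C] assms(3)
      midpoint_in_closed_segment[of a b] unfolding z_def by blast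
  have zo: "z \<in> open_segment a b" using ab by (simp add: z_def)
  have "dist z c < 1"
    by (rule dist_convex_less_1[OF ab(3) _ _ zo]) (use ab assms(3) c in \<open>auto simp: disk_intersection_iff\<close>)
  have "connected (closed_segment z p)" by simp
  then have "connected ((\<lambda>y. dist y c) ` closed_segment z p)"
    by (intro connected_continuous_image continuous_intros)
  then have "1 \<in> (\<lambda>y. dist y c) ` closed_segment z p"
    by (rule connectedD_interval[of _ "dist z c" "dist p c"]) (use \<open>dist z c < 1\<close> pc in auto)
  then obtain q where q: "q \<in> closed_segment z p" "dist q c = 1" by auto
  have qo: "q \<in> open_segment z p"
    using q \<open>dist z c < 1\<close> pc by (auto simp: open_segment_def)
  have "z \<noteq> p" using zR p(1) by auto
  define U where "U = (\<Inter>d\<in>C - {c}. ball d 1)"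
  have qU: "q \<in> U"
    using dist_convex_less_1[OF \<open>z \<noteq> p\<close> _ _ qo] zR pd assms(3)
    by (auto simp: U_def disk_intersection_iff dist_commute)
  have "open U" using assms(2) by (auto simp: U_def)
  have UR: "U \<inter> sphere c 1 \<subseteq> R"
  proof
    fix x assume "x \<in> U \<inter> sphere c 1"
    then have "dist x d \<le> 1" if "d \<in> C" for d
      using that by (cases "d = c") (auto simp: U_def dist_commute less_imp_le)
    then show "x \<in> R" using assms(3) by (simp add: disk_intersection_iff)
  qed
  \<comment> \<open>A circle has no isolated points, so the neighbourhood \<open>U\<close> of
    \<open>q\<close> contains a second point of it.\<close>
  have "q islimpt sphere c 1"
  proof (rule connected_imp_perfect)
    show "connected (sphere c 1)" by (rule connected_sphere) simp
    have "c + axis 1 1 \<in> sphere c 1" "c - axis 1 1 \<in> sphere c 1" by (auto simp: dist_norm)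
    moreover have "c + axis 1 1 \<noteq> c - axis 1 1" by (simp add: vec_eq_2)
    ultimately show "sphere c 1 \<noteq> {x}" for x by (metis singletonD)
  qed (use q in \<open>auto simp: dist_commute\<close>)
  then obtain q' where q': "q' \<in> sphere c 1" "q' \<in> U" "q' \<noteq> q"
    using \<open>open U\<close> qU by (auto simp: islimpt_def)
  have qR: "q \<in> R" "q' \<in> R" using UR qU q q' by (auto simp: dist_commute)
  have n: "unit_outer_normal R r (r - c)" if "dist r c = 1" for r
    by (rule unit_outer_normal_diff) (use assms(3) c that in \<open>auto simp: disk_intersection_iff\<close>)
  have "q - (q - c) \<in> R"
    by (rule constant_width_minus_normal[OF assms(1) qR(1) n]) (use q in auto)
  then have cR: "c \<in> R" by simp
  have n': "unit_outer_normal R c (c - r)" if "r \<in> R" "dist r c = 1" for r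
    by (rule unit_outer_normal_diff) (use that constant_width_dist_le[OF assms(1)] in \<open>auto simp: dist_commute\<close>)
  have "unit_outer_normal R c (c - q)" "unit_outer_normal R c (c - q')" "c - q \<noteq> c - q'"
    using n' qR q q' by (auto simp: dist_commute)
  then show "c \<in> vertices R"
    by (rule verticesI[OF cR])
qed

text \<open>The unit normals at a vertex \<open>p\<close> form an arc, so \<open>R\<close> contains infinitely many points at
  distance \<open>1\<close> from \<open>p\<close>; if \<open>p\<close> were not a centre, each would lie on a second one of
  finitely many circles.\<close>

lemma vertices_subset_centres:
  assumes "constant_width R" "finite C" "R = disk_intersection C"
  shows "vertices R \<subseteq> C"
proof (rule subsetI, rule ccontr)
  fix p assume p: "p \<in> vertices R" "p \<notin> C"
  have pR: "p \<in> R"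
    using vertices_subset[OF closed_disk_intersection] p(1) assms(3) by auto
  obtain u w where uw: "unit_outer_normal R p u" "unit_outer_normal R p w" "u \<noteq> w"
    using p by (auto simp: vertices_def)
  then have nuw: "norm u = 1" "norm w = 1" by (auto simp: unit_outer_normal_def)
  define m where "m t = (1 - t) *\<^sub>R u + t *\<^sub>R w" for t :: real
  \<comment> \<open>The segment from \<open>u\<close> to \<open>w\<close> could only pass through 0
    for \<open>w = - u\<close>, and opposite normals at one point would make the width in that
    direction zero.\<close>
  have m0: "m t \<noteq> 0" if t: "t \<in> {0..1}" for t
  proof
    assume "m t = 0"
    then have *: "(1 - t) *\<^sub>R u = - (t *\<^sub>R w)" by (simp add: m_def eq_neg_iff_add_eq_0)
    then have "norm ((1 - t) *\<^sub>R u) = norm (t *\<^sub>R w)" by (metis norm_minus_cancel)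
    then have "t = 1/2" using t nuw by simp
    then have "(1/2) *\<^sub>R u = (1/2) *\<^sub>R (- w)" using * \<open>t = 1/2\<close> by simp
    then have "w = - u" by (simp only: scaleR_cancel_left) auto
    obtain r where r: "r \<in> R" "u \<bullet> r = u \<bullet> p - 1"
      using constant_width_opposite[OF assms(1) pR uw(1)] by auto
    then have "w \<bullet> r \<le> w \<bullet> p" using uw(2) by (auto simp: unit_outer_normal_def)
    then show False using r \<open>w = - u\<close> by simp
  qed
  define f where "f t = p - m t /\<^sub>R norm (m t)" for t
  have "f t \<in> R \<inter> sphere p 1" if "t \<in> {0..1}" for t
  proof -
    have "unit_outer_normal R p (((1 - t) / norm (m t)) *\<^sub>R u + (t / norm (m t)) *\<^sub>R w)"
    proof (rule unit_outer_normal_combination[OF uw(1,2)])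
      have "((1 - t) / norm (m t)) *\<^sub>R u + (t / norm (m t)) *\<^sub>R w = m t /\<^sub>R norm (m t)"
        by (simp add: m_def scaleR_add_right divide_inverse mult.commute)
      then show "norm (((1 - t) / norm (m t)) *\<^sub>R u + (t / norm (m t)) *\<^sub>R w) = 1"
        using m0[OF that] by simp
    qed (use that in auto)
    moreover have "((1 - t) / norm (m t)) *\<^sub>R u + (t / norm (m t)) *\<^sub>R w = m t /\<^sub>R norm (m t)"
      by (simp add: m_def scaleR_add_right divide_inverse mult.commute)
    ultimately have "f t \<in> R"
      using constant_width_minus_normal[OF assms(1) pR] by (simp add: f_def)
    then show ?thesis using m0[OF that] by (simp add: f_def dist_norm)
  qed
  then have sub: "f ` {0..1} \<subseteq> (\<Union>c\<in>C. sphere p 1 \<inter> sphere c 1)"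
  proof -
    have "\<exists>c\<in>C. dist q c = 1" if q: "q \<in> R" "dist p q = 1" for q
    proof -
      have "unit_outer_normal R q (q - p)"
        by (rule unit_outer_normal_diff)
          (use q pR constant_width_dist_le[OF assms(1)] in \<open>auto simp: dist_commute\<close>)
      then show ?thesis
        using unit_outer_normal_frontier[OF q(1)] frontier_disk_intersection[OF assms(2)] assms(3) by auto
    qed
    then show ?thesis
      using \<open>\<And>t. t \<in> {0..1} \<Longrightarrow> f t \<in> R \<inter> sphere p 1\<close> by (fastforce simp: dist_commute)
  qed
  have "finite (\<Union>c\<in>C. sphere p 1 \<inter> sphere c 1)"
    by (intro finite_UN_I assms(2) finite_sphere_Int_sphere) (use p(2) in auto)
  then have "finite (f ` {0..1})" using sub finite_subset by blast
  \<comment> \<open>A finite connected set has at most one point, but \<open>f\<close> takes the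
    different values \<open>p - u\<close> and \<open>p - w\<close> at the ends.\<close>
  moreover have "connected (f ` {0..1})"
    unfolding f_def m_def using m0 by (intro connected_continuous_image continuous_intros) (auto simp: m_def)
  ultimately obtain x where "f ` {0..1} \<subseteq> {x}" using connected_finite_iff_sing[of "f ` {0..1}"] by auto
  moreover have "f 0 \<in> f ` {0..1}" "f 1 \<in> f ` {0..1}" by auto
  ultimately have "f 0 = f 1" by blast
  then show False using nuw uw by (simp add: f_def m_def)
qed

lemma reuleaux_polygon_centres:
  assumes "reuleaux_polygon R"
  shows "R = disk_intersection (vertices R)" "finite (vertices R)"
proof -
  have cw: "constant_width R" and "\<exists>C. finite C \<and> R = disk_intersection C"
    using assms by (auto simp: reuleaux_polygon_def)
  then have "\<exists>m C. finite C \<and> card C = m \<and> R = disk_intersection C" by auto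
  then have "\<exists>C. finite C \<and> card C = num_sides R \<and> R = disk_intersection C"
    unfolding num_sides_def by (rule LeastI_ex)
  then obtain C where C: "finite C" "card C = num_sides R" "R = disk_intersection C" by auto
  have "R \<noteq> disk_intersection (C - {c})" if "c \<in> C" for c
  proof
    assume "R = disk_intersection (C - {c})"
    then have "num_sides R \<le> card (C - {c})"
      unfolding num_sides_def using C(1) by (intro Least_le) auto
    moreover have "card (C - {c}) < card C" using C(1) that by (rule card_Diff1_less)
    ultimately show False using C(2) by simp
  qed
  then have "vertices R = C"
    using finite_centres_subset_vertices[OF cw C(1,3)] vertices_subset_centres[OF cw C(1,3)] by auto
  then show "R = disk_intersection (vertices R)" "finite (vertices R)" using C by auto
qed

section \<open>Diameters issuing from a vertex\<close>

lemma connected_punctured_circle: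
  fixes a :: "real^2"
  assumes "dist a v = 1"
  shows "connected (sphere a 1 - {v})"
proof -
  have "sphere a 1 - {v} homeomorphic {x :: real^2. axis 1 1 \<bullet> x = 0}"
    by (rule homeomorphic_punctured_sphere_hyperplane) (use assms in auto)
  moreover have "connected {x :: real^2. axis 1 1 \<bullet> x = 0}"
    by (intro convex_connected convex_hyperplane)
  ultimately show ?thesis by (metis homeomorphic_connectedness)
qed

text \<open>Away from vertices, the set of points of \<open>R\<close> at distance \<open>1\<close> from \<open>p\<close> is both open and
  closed in the unit circle about \<open>p\<close>, which would be contained in \<open>R\<close> if it had only one
  vertex on it.\<close>

lemma reuleaux_polygon_two_opposite_vertices:
  assumes "reuleaux_polygon R" "p \<in> vertices R"
  obtains a b where "a \<in> vertices R" "b \<in> vertices R" "a \<noteq> b" "dist p a = 1" "dist p b = 1"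
proof (rule ccontr)
  assume neg: "\<not> thesis"
  have cw: "constant_width R" using assms(1) by (simp add: reuleaux_polygon_def)
  have Rd: "R = disk_intersection (vertices R)" and fin: "finite (vertices R)"
    using reuleaux_polygon_centres[OF assms(1)] by auto
  have "closed R" using Rd closed_disk_intersection by metis
  then have VR: "vertices R \<subseteq> R" by (rule vertices_subset)
  define A where "A = R \<inter> sphere p 1"
  obtain u w where uw: "unit_outer_normal R p u" "unit_outer_normal R p w" "u \<noteq> w"
    using assms(2) by (auto simp: vertices_def)
  have uwA: "p - u \<in> A" "p - w \<in> A"
    using constant_width_minus_normal[OF cw] uw VR assms(2)
    by (auto simp: A_def dist_norm unit_outer_normal_def)
  \<comment> \<open>If there is no vertex on the circle at all, any of its points may be removed in
    place of \<open>v\<close>.\<close>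
  have "\<exists>v \<in> sphere p 1. A \<inter> vertices R \<subseteq> {v}"
  proof (cases "A \<inter> vertices R = {}")
    case True
    then show ?thesis using uwA(1) unfolding A_def by blast
  next
    case False
    then obtain v where v: "v \<in> A" "v \<in> vertices R" by auto
    have "x = v" if "x \<in> A \<inter> vertices R" for x
      using neg \<open>\<And>b a. \<lbrakk>a \<in> vertices R; b \<in> vertices R; a \<noteq> b; dist p a = 1; dist p b = 1\<rbrakk> \<Longrightarrow> thesis\<close>[of x v] that v
      by (auto simp: A_def)
    then have "A \<inter> vertices R \<subseteq> {v}" by auto
    then show ?thesis using v by (auto simp: A_def)
  qed
  then obtain v where v: "dist p v = 1" "A \<inter> vertices R \<subseteq> {v}" by auto
  define S where "S = sphere p 1 - {v}"
  have conn: "connected S" unfolding S_def by (rule connected_punctured_circle[OF v(1)])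
  have "A - {v} = S \<inter> R" by (auto simp: A_def S_def)
  then have cl: "closedin (top_of_set S) (A - {v})"
    using \<open>closed R\<close> by (auto simp: closedin_closed)
  have op: "openin (top_of_set S) (A - {v})"
    unfolding openin_open
  proof (intro exI conjI)
    let ?U = "\<Inter>c\<in>vertices R - {p}. ball c 1"
    show "open ?U" using fin by auto
    show "A - {v} = S \<inter> ?U"
    proof (intro equalityI subsetI)
      fix q assume q: "q \<in> A - {v}"
      have qR: "q \<in> R" "dist q p = 1" using q by (auto simp: A_def dist_commute)
      have n: "unit_outer_normal R q (q - c)" if "c \<in> vertices R" "dist q c = 1" for c
        by (rule unit_outer_normal_diff) (use that VR constant_width_dist_le[OF cw] in auto)
      have "dist q c < 1" if c: "c \<in> vertices R" "c \<noteq> p" for c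
      proof (rule ccontr)
        assume "\<not> dist q c < 1"
        then have "dist q c = 1" using constant_width_dist_le[OF cw qR(1)] c VR by force
        then have "q \<in> vertices R"
          using verticesI[OF qR(1) n[OF c(1)] n[OF assms(2) qR(2)]] c(2) by simp
        then show False using q v by auto
      qed
      then show "q \<in> S \<inter> ?U" using q by (auto simp: S_def A_def dist_commute)
    next
      fix q assume "q \<in> S \<inter> ?U"
      then have "dist q c \<le> 1" if "c \<in> vertices R" for c
        using that by (cases "c = p") (auto simp: S_def dist_commute less_imp_le)
      then have "q \<in> R" by (subst Rd) (simp add: disk_intersection_iff)
      then show "q \<in> A - {v}" using \<open>q \<in> S \<inter> ?U\<close> by (auto simp: A_def S_def)
    qed
  qed
  have "p - u \<noteq> p - w" using uw(3) by simp
  then have "A - {v} \<noteq> {}" using uwA by blast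
  then have "A - {v} = S" using conn cl op by (auto simp: connected_clopen)
  \<comment> \<open>The quarter turn provides two antipodal points of the circle that both differ
    from \<open>v\<close>; they would lie in \<open>R\<close> at distance 2.\<close>
  define d where "d = perp (v - p)"
  have nd: "norm d = 1" using v(1) by (simp add: d_def dist_norm norm_minus_commute)
  have perp_ne: "perp e \<noteq> e" "perp e \<noteq> - e" if "e \<noteq> 0" for e
    using that by (auto simp: vec_eq_2)
  have "v - p \<noteq> 0" using v(1) by auto
  from perp_ne[OF this] have "p + d \<noteq> v" "p - d \<noteq> v"
    unfolding d_def by (metis add_diff_cancel_left', metis diff_diff_eq2 minus_diff_eq add_diff_cancel_left')
  then have "p + d \<in> S" "p - d \<in> S" using nd by (auto simp: S_def dist_norm)
  then have "p + d \<in> R" "p - d \<in> R" using \<open>A - {v} = S\<close> by (auto simp: A_def)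
  then have "dist (p + d) (p - d) \<le> 1" by (rule constant_width_dist_le[OF cw])
  moreover have "dist (p + d) (p - d) = 2 * norm d"
    by (simp add: dist_norm scaleR_2[symmetric])
  ultimately show False using nd by simp
qed

subsection \<open>Combinatorics of the diameters\<close>

locale reuleaux_ccw =
  fixes R :: "(real^2) set" and x :: "nat \<Rightarrow> real^2" and n k :: nat
  assumes R: "reuleaux_polygon R" and n: "num_sides R = n" "n = 2 * k + 1" "n \<ge> 5"
    and lab: "ccw_labelling R x"
begin

definition X :: "nat \<Rightarrow> real^2" where "X i = x (i mod n)"

lemma n_pos: "n > 0" "k \<ge> 2" using n by auto

lemma X_add_n [simp]: "X (i + n) = X i" by (simp add: X_def)

lemma constant_width: "constant_width R"
  using R by (simp add: reuleaux_polygon_def)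

lemma vertices_eq: "vertices R = x ` {..<n}" "inj_on x {..<n}"
  using lab n by (auto simp: ccw_labelling_def bij_betw_def)

lemma vertices_range: "vertices R = range X"
proof -
  have "range X = x ` (\<lambda>i. i mod n) ` UNIV" by (auto simp: X_def)
  also have "(\<lambda>i. i mod n) ` UNIV = {..<n}"
    using n_pos by (auto simp: image_iff) (metis mod_less)
  finally show ?thesis using vertices_eq by simp
qed

lemma R_eq: "R = disk_intersection (range X)"
  using reuleaux_polygon_centres(1)[OF R] by (simp add: vertices_range)

lemma R_iff: "p \<in> R \<longleftrightarrow> (\<forall>i. dist p (X i) \<le> 1)"
  by (subst R_eq) (simp add: disk_intersection_iff)

lemma closed_R: "closed R" and convex_R: "convex R"
  using R_eq closed_disk_intersection convex_disk_intersection by metis+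

lemma X_in_vertices [simp]: "X i \<in> vertices R"
  by (simp add: vertices_range)

lemma X_in_R [simp]: "X i \<in> R"
  using vertices_subset[OF closed_R] by auto

lemma dist_X_le: "dist (X i) (X j) \<le> 1"
  by (intro constant_width_dist_le[OF constant_width]) auto

lemma X_eq_iff: "X i = X j \<longleftrightarrow> i mod n = j mod n"
  using vertices_eq(2) n_pos by (auto simp: X_def inj_on_def)

text \<open>Reduction modulo \<open>n\<close> only rotates the triple cyclically, which preserves
  \<open>orient\<close>. The three cases are whether none, one or two of the indices wrap
  around.\<close>

lemma orient_X_pos:
  assumes "0 < a" "a < b" "b < n"
  shows "orient (X i) (X (i + a)) (X (i + b)) > 0"
proof -
  define m where "m = i mod n"
  have m: "m < n" using n_pos by (simp add: m_def)
  have pos: "orient (x p) (x q) (x r) > 0" if "p < q" "q < r" "r < n" for p q r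
    using lab n(1) that by (auto simp: ccw_labelling_def)
  have X: "X (i + c) = (if m + c < n then x (m + c) else x (m + c - n))" if "c < n" for c
  proof -
    have "X (i + c) = x ((m + c) mod n)" by (simp add: X_def m_def mod_add_left_eq)
    also have "(m + c) mod n = (if m + c < n then m + c else m + c - n)"
      using m that by (auto simp: mod_if)
    finally show ?thesis by simp
  qed
  have X0: "X i = x m" using X[of 0] n_pos m by simp
  consider "m + b < n" | "m + a < n" "m + b \<ge> n" | "m + a \<ge> n" using assms by linarith
  then show ?thesis
  proof cases
    case 1
    then show ?thesis using X0 X[of a] X[of b] assms pos[of m "m + a" "m + b"] by simp
  next
    case 2
    then show ?thesis using X0 X[of a] X[of b] assms pos[of "m + b - n" m "m + a"] m
        orient_rotate[of "x m" "x (m + a)" "x (m + b - n)"]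
      by simp
  next
    case 3
    then show ?thesis using X0 X[of a] X[of b] assms pos[of "m + a - n" "m + b - n" m] m
        orient_rotate[of "x (m + a - n)" "x (m + b - n)" "x m"] by simp
  qed
qed

end

text \<open>In a convex quadrilateral the diagonals are together longer than two opposite sides.\<close>

lemma convex_quadrilateral_sides:
  fixes a b c d :: "real^2"
  assumes o: "orient a b c > 0" "orient a b d > 0" "orient a c d > 0" "orient b c d > 0"
    and "dist a c \<le> 1" "dist b d \<le> 1" "dist a b = 1" "dist c d = 1"
  shows False
proof -
  \<comment> \<open>\<open>D\<close> is twice the area of the quadrilateral, obtained from either
    diagonal; the ratios \<open>s\<close> and \<open>r\<close> locate the crossing point
    \<open>z\<close> of the diagonals on each of them.\<close>
  define D where "D = orient a b c + orient a c d"
  have D: "D > 0" "D = orient a b d + orient b c d"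
    using o by (simp_all add: D_def orient_def algebra_simps)
  define s where "s = orient a b c / D"
  define r where "r = orient a b d / D"
  define z where "z = (1 - s) *\<^sub>R b + s *\<^sub>R d"
  have s: "0 < s" "s < 1" and r: "0 < r" "r < 1"
    using o D by (auto simp: s_def r_def D_def[symmetric] divide_simps) (auto simp: D_def)
  have "D *\<^sub>R z = (D - orient a b c) *\<^sub>R b + orient a b c *\<^sub>R d"
    using D(1) by (simp add: z_def s_def scaleR_add_right algebra_simps)
  also have "\<dots> = (D - orient a b d) *\<^sub>R a + orient a b d *\<^sub>R c"
    by (simp add: D_def orient_def vec_eq_2 algebra_simps)
  also have "\<dots> = D *\<^sub>R ((1 - r) *\<^sub>R a + r *\<^sub>R c)"
    using D(1) by (simp add: r_def scaleR_add_right algebra_simps)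
  finally have z2: "z = (1 - r) *\<^sub>R a + r *\<^sub>R c" using D(1) by simp
  have "z \<in> closed_segment b d" "z \<in> closed_segment a c"
    using s r z_def z2 unfolding closed_segment_def mem_Collect_eq by (metis less_imp_le)+
  then have "dist b d = dist b z + dist z d" "dist a c = dist a z + dist z c"
    by (metis between between_mem_segment)+
  moreover have "dist a b \<le> dist a z + dist z b" "dist c d \<le> dist c z + dist z d"
    by (rule dist_triangle)+
  ultimately have "dist a b = dist a z + dist z b"
    using assms(5-8) by (simp add: dist_commute)
  then have "z \<in> closed_segment a b" by (metis between between_mem_segment)
  then obtain t where zt: "z = (1 - t) *\<^sub>R a + t *\<^sub>R b" by (auto simp: closed_segment_def)
  \<comment> \<open>The lengths leave no slack in the triangle inequalities, which puts
    \<open>z\<close> on the side \<open>a b\<close>; but \<open>z\<close> is strictly on its inner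
    side.\<close>
  have "orient a b z = 0" unfolding zt by (simp add: orient_def algebra_simps)
  moreover have "orient a b z = s * orient a b d" by (simp add: z_def orient_def algebra_simps)
  ultimately show False using s o by simp
qed

context reuleaux_ccw begin

text \<open>In this cyclic order the two diameters would be opposite sides of a convex
  quadrilateral, whose diagonals have length at most 1. Hence diameters without a common end always
  cross.\<close>

lemma diameters_cross:
  assumes "0 < a" "a < b" "b < c" "c < n"
    and "dist (X i) (X (i + a)) = 1" "dist (X (i + b)) (X (i + c)) = 1"
  shows False
proof (rule convex_quadrilateral_sides[of "X i" "X (i + a)" "X (i + b)" "X (i + c)"])
  show "orient (X (i + a)) (X (i + b)) (X (i + c)) > 0"
    using orient_X_pos[of "b - a" "c - a" "i + a"] assms by simp
qed (use assms dist_X_le orient_X_pos in auto)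

definition N :: "nat \<Rightarrow> nat set" where
  "N i = {a. 0 < a \<and> a < n \<and> dist (X i) (X (i + a)) = 1}"

lemma offset_exists:
  assumes "dist (X i) (X j) = 1"
  obtains a where "a \<in> N i" "X (i + a) = X j"
proof -
  define a where "a = (j + (n - i mod n)) mod n"
  have "(i + a) mod n = j mod n"
  proof -
    have "(i + a) mod n = (i mod n + (j + (n - i mod n))) mod n"
      by (simp add: a_def mod_add_left_eq mod_add_right_eq)
    also have "i mod n + (j + (n - i mod n)) = j + n"
      using n_pos mod_less_divisor[of n i] by linarith
    finally show ?thesis by simp
  qed
  then have eq: "X (i + a) = X j" by (simp add: X_eq_iff)
  have "a \<noteq> 0" using eq assms by (cases "a = 0") auto
  moreover have "a < n" using n_pos by (simp add: a_def)
  ultimately show ?thesis using that[of a] eq assms by (simp add: N_def)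
qed

lemma N_two: obtains a b where "a \<in> N i" "b \<in> N i" "a < b"
proof -
  obtain p q where pq: "p \<in> vertices R" "q \<in> vertices R" "p \<noteq> q" "dist (X i) p = 1" "dist (X i) q = 1"
    using reuleaux_polygon_two_opposite_vertices[OF R, of "X i"] by auto
  then obtain j l where jl: "p = X j" "q = X l" by (auto simp: vertices_range)
  obtain a where a: "a \<in> N i" "X (i + a) = X j" using pq jl offset_exists by metis
  obtain b where b: "b \<in> N i" "X (i + b) = X l" using pq jl offset_exists by metis
  have "a \<noteq> b" using pq jl a b by auto
  then show ?thesis using a b that by (meson nat_neq_iff)
qed

text \<open>A diameter from a vertex strictly between the two ends must meet both diameters issuing
  from \<open>X i\<close>, which forces it to end at \<open>X i\<close>. That vertex would have a
  single diameter, but every vertex has two.\<close>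

lemma N_consecutive:
  assumes "a \<in> N i" "b \<in> N i" "a < b"
  shows "b = a + 1"
proof (rule ccontr)
  assume "b \<noteq> a + 1"
  define r where "r = a + 1"
  have r: "a < r" "r < b" using \<open>b \<noteq> a + 1\<close> assms(3) by (auto simp: r_def)
  have ab: "0 < a" "b < n" "dist (X i) (X (i + a)) = 1" "dist (X i) (X (i + b)) = 1"
    using assms by (auto simp: N_def)
  have only: "r + c = n" if c: "c \<in> N (i + r)" for c
  proof (rule ccontr)
    assume ne: "r + c \<noteq> n"
    have c': "0 < c" "c < n" "dist (X (i + r)) (X (i + r + c)) = 1" using c by (auto simp: N_def)
    consider "r + c < n" | "r + c > n" using ne by linarith
    then show False
    proof cases
      case 1
      then show False
        using diameters_cross[of a r "r + c" i] ab c' r by (simp add: add.assoc)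
    next
      case 2
      define q where "q = r + c - n"
      have q: "0 < q" "q < r" "r + c = q + n" using 2 c' by (auto simp: q_def)
      have "X (i + r + c) = X (i + q)"
        using q(3) X_add_n[of "i + q"] by (simp add: add.assoc)
      then have e: "dist (X (i + q)) (X (i + r)) = 1" using c'(3) by (simp add: dist_commute)
      have "dist (X (i + q + (b - q))) (X (i + q + (n - q))) = 1"
        using ab(4) q r ab(2) X_add_n[of i] by (simp add: dist_commute)
      moreover have "0 < r - q" "r - q < b - q" "b - q < n - q" "n - q < n" using q r ab by linarith+
      ultimately show False
        using diameters_cross[of "r - q" "b - q" "n - q" "i + q"] e q r ab by simp
    qed
  qed
  obtain c d where "c \<in> N (i + r)" "d \<in> N (i + r)" "c < d" using N_two by blast
  then show False using only[of c] only[of d] by simp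
qed

lemma N_Ex: "\<exists>a. N i = {a, a + 1}"
proof -
  obtain a b where ab: "a \<in> N i" "b \<in> N i" "a < b" by (rule N_two)
  have "c = a \<or> c = b" if "c \<in> N i" for c
    using N_consecutive[OF that ab(1)] N_consecutive[OF ab(1) that] N_consecutive[OF that ab(2)]
      N_consecutive[OF ab(2) that] N_consecutive[OF ab] by linarith
  then have "N i = {a, a + 1}" using ab N_consecutive[OF ab] by auto
  then show ?thesis ..
qed

text \<open>Diameters from adjacent vertices meet, so the smaller offset \<open>f i\<close> cannot
  decrease with \<open>i\<close>; being periodic it is a constant \<open>F\<close>. Read from its
  other end, a diameter of offset \<open>F\<close> has offset \<open>n - F\<close>, which must be
  \<open>F\<close> or \<open>F + 1\<close>. As \<open>n\<close> is odd,
  \<open>F = k\<close>.\<close>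

lemma N_eq: "N i = {k, k + 1}"
proof -
  obtain f where f: "\<And>i. N i = {f i, f i + 1}" using N_Ex by metis
  have f_in: "f i \<in> N i" "f i + 1 \<in> N i" for i using f by auto
  have mono: "f i \<le> f (Suc i)" for i
  proof (rule ccontr)
    assume "\<not> ?thesis"
    then have l: "f (Suc i) < f i" by simp
    have fi: "dist (X i) (X (i + (f i + 1))) = 1" "f i + 1 < n"
      and fs: "dist (X (Suc i)) (X (Suc i + f (Suc i))) = 1" "0 < f (Suc i)"
      using f_in[of i] f_in[of "Suc i"] unfolding N_def mem_Collect_eq by auto
    have "dist (X (Suc i + f i)) (X (Suc i + (n - 1))) = 1"
      using fi n_pos X_add_n[of i] by (simp add: dist_commute)
    moreover have "f i < n - 1" "n - 1 < n" using fi n_pos by linarith+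
    ultimately show False
      using diameters_cross[of "f (Suc i)" "f i" "n - 1" "Suc i"] fs fi l by simp
  qed
  have "N (i + n) = N i" for i
  proof -
    have "X (i + n + a) = X (i + a)" for a
      using X_add_n[of "i + a"] by (simp add: add.assoc add.commute add.left_commute)
    then show ?thesis by (simp add: N_def)
  qed
  then have per: "f (i + n) = f i" for i
  proof -
    have "{f (i + n), f (i + n) + 1} = {f i, f i + 1}" using f[of i] f[of "i + n"] \<open>\<And>i. N (i + n) = N i\<close>[of i] by simp
    then show ?thesis unfolding doubleton_eq_iff by linarith
  qed
  have le: "f i \<le> f (i + j)" for i j
    by (rule lift_Suc_mono_le[of f, OF mono]) simp
  define F where "F = f i"
  have const: "f (i + j) = F" if "j \<le> n" for j
  proof -
    have "f (i + j) \<le> f (i + j + (n - j))" by (rule le)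
    also have "i + j + (n - j) = i + n" using that by simp
    finally show ?thesis using le[of i j] per[of i] by (simp add: F_def)
  qed
  have F: "0 < F" "F < n" "dist (X i) (X (i + F)) = 1" using f_in(1)[of i] by (auto simp: N_def F_def)
  then have "n - F \<in> N (i + F)" using X_add_n[of i] by (auto simp: N_def dist_commute)
  then have "n - F = F \<or> n - F = F + 1" using f[of "i + F"] const[of F] F by auto
  then have "F = k" using n F by linarith
  then show ?thesis using f[of i] F_def by simp
qed

lemma dist_X_k: "dist (X i) (X (i + k)) = 1" "dist (X i) (X (i + (k + 1))) = 1"
proof -
  have "k \<in> N i" "k + 1 \<in> N i" unfolding N_eq by auto
  then show "dist (X i) (X (i + k)) = 1" "dist (X i) (X (i + (k + 1))) = 1"
    unfolding N_def by auto
qed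

end

subsection \<open>Area of a circular segment\<close>

definition cap :: "real^2 \<Rightarrow> real \<Rightarrow> (real^2) set" where
  "cap u s = {p \<in> cball 0 1. u \<bullet> p > s}"

lemma cap_lmeasurable: "cap u s \<in> lmeasurable"
proof -
  have "cap u s = cball 0 1 \<inter> {p. u \<bullet> p > s}" by (auto simp: cap_def)
  moreover have "open {p. u \<bullet> p > s}" by (simp add: open_halfspace_gt)
  ultimately show ?thesis
    by (simp add: bounded_set_imp_lmeasurable fmeasurable_Int_fmeasurable)
qed

lemma orthogonal_image_cap:
  fixes f :: "real^2 \<Rightarrow> real^2"
  assumes "orthogonal_transformation f"
  shows "f ` cap u s = cap (f u) s"
proof -
  have b: "f ` cball 0 1 = cball 0 1"
    using image_orthogonal_transformation_cball[OF assms, of 0 1] assms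
    by (simp add: orthogonal_transformation_linear linear_0)
  have i: "f u \<bullet> f p = u \<bullet> p" for p
    using assms by (simp add: orthogonal_transformation_def)
  show ?thesis
  proof (intro equalityI subsetI)
    fix y assume "y \<in> cap (f u) s"
    then have "y \<in> f ` cball 0 1" "f u \<bullet> y > s" by (auto simp: cap_def b simp del: mem_cball)
    then obtain x where "x \<in> cball 0 1" "y = f x" "f u \<bullet> y > s" by blast
    then show "y \<in> f ` cap u s" by (auto simp: cap_def i)
  next
    fix y assume "y \<in> f ` cap u s"
    then obtain x where x: "x \<in> cball 0 1" "y = f x" "u \<bullet> x > s" by (auto simp: cap_def)
    then have "f x \<in> cball 0 1" using b by blast
    then show "y \<in> cap (f u) s" using x by (simp add: cap_def i)
  qed
qed

lemma box_2_measure: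
  fixes a b :: "real^2"
  assumes "a$1 \<le> b$1" "a$2 \<le> b$2"
  shows "measure lebesgue (cbox a b) = (b$1 - a$1) * (b$2 - a$2)"
proof -
  have "cbox a b \<noteq> {}" using assms by (auto simp: interval_ne_empty_cart forall_2)
  then show ?thesis by (simp add: content_cbox_cart UNIV_2)
qed

lemma measure_cap_axis_le:
  assumes "0 \<le> s" "s \<le> 1" "0 \<le> s'" "s' \<le> 1"
  shows "measure lebesgue (cap (axis 1 1) s) \<le>
    measure lebesgue (cap (axis 1 1) s') + 2 * sqrt (1 - s\<^sup>2) * (s' - s)"
proof -
  define r where "r = sqrt (1 - s\<^sup>2)"
  have r: "r \<ge> 0" "r\<^sup>2 = 1 - s\<^sup>2" using assms by (auto simp: r_def abs_square_le_1)
  have mem: "p \<in> cap (axis 1 1) t \<longleftrightarrow> p$1 * p$1 + p$2 * p$2 \<le> 1 \<and> p$1 > t" for p t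
    by (simp add: cap_def inner_2 axis_def norm_le_square)
  show ?thesis
  proof (cases "s \<le> s'")
    case True
    define B where "B = cbox (vector [s, -r] :: real^2) (vector [s', r])"
    have "cap (axis 1 1) s \<subseteq> cap (axis 1 1) s' \<union> B"
    proof
      fix p assume p: "p \<in> cap (axis 1 1) s"
      then have "p$1 * p$1 + p$2 * p$2 \<le> 1" "p$1 > s" by (auto simp: mem)
      moreover have "s * s \<le> p$1 * p$1" using \<open>p$1 > s\<close> assms(1) by (intro mult_mono) auto
      ultimately have "(p$2)\<^sup>2 \<le> r\<^sup>2" using r by (simp add: power2_eq_square)
      then have "\<bar>p$2\<bar> \<le> r" using r(1) abs_le_square_iff[of "p$2" r] by simp
      then show "p \<in> cap (axis 1 1) s' \<union> B"
        using p by (auto simp: mem B_def mem_box_cart forall_2)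
    qed
    then have "measure lebesgue (cap (axis 1 1) s) \<le> measure lebesgue (cap (axis 1 1) s' \<union> B)"
    proof (rule measure_mono_fmeasurable)
      show "cap (axis 1 1) s \<in> sets lebesgue" using cap_lmeasurable by (rule fmeasurableD)
      show "cap (axis 1 1) s' \<union> B \<in> lmeasurable"
        unfolding B_def by (intro fmeasurable.Un cap_lmeasurable) auto
    qed
    also have "\<dots> \<le> measure lebesgue (cap (axis 1 1) s') + measure lebesgue B"
      by (rule measure_Un_le) (auto simp: B_def cap_lmeasurable fmeasurableD)
    also have "measure lebesgue B = (s' - s) * (2 * r)"
      unfolding B_def using True r by (subst box_2_measure) auto
    finally show ?thesis by (simp add: r_def algebra_simps)
  next
    case False
    define B where "B = cbox (vector [s', -r] :: real^2) (vector [s, r])"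
    \<comment> \<open>The cap does not contain its chord, so the left edge of the rectangle
      \<open>B\<close> must be added; it is a null set.\<close>
    define L where "L = cbox (vector [s', -r] :: real^2) (vector [s', r])"
    have sub: "cap (axis 1 1) s \<union> B \<subseteq> cap (axis 1 1) s' \<union> L"
    proof
      fix p assume p: "p \<in> cap (axis 1 1) s \<union> B"
      have "p \<in> cap (axis 1 1) s' \<union> L" if "p \<in> B"
      proof -
        have b: "s' \<le> p$1" "p$1 \<le> s" "\<bar>p$2\<bar> \<le> r"
          using that by (auto simp: B_def mem_box_cart forall_2)
        have "p$1 * p$1 \<le> s * s" using b assms by (intro mult_mono) auto
        moreover have "(p$2)\<^sup>2 \<le> r\<^sup>2" using b(3) r(1) abs_le_square_iff[of "p$2" r] by simp
        ultimately have "p$1 * p$1 + p$2 * p$2 \<le> 1" using r by (simp add: power2_eq_square)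
        then show ?thesis
          using b by (auto simp: mem L_def mem_box_cart forall_2)
      qed
      then show "p \<in> cap (axis 1 1) s' \<union> L"
        using p False by (auto simp: mem)
    qed
    have "cap (axis 1 1) s \<inter> B = {}" by (auto simp: mem B_def mem_box_cart forall_2)
    then have "measure lebesgue (cap (axis 1 1) s) + measure lebesgue B = measure lebesgue (cap (axis 1 1) s \<union> B)"
      using cap_lmeasurable[THEN fmeasurableD2, of "axis 1 1" s] fmeasurableD2[of B lebesgue]
      by (intro measure_Union[symmetric]) (auto simp: B_def cap_lmeasurable[THEN fmeasurableD] fmeasurableD2)
    also have "\<dots> \<le> measure lebesgue (cap (axis 1 1) s' \<union> L)"
    proof (rule measure_mono_fmeasurable[OF sub])
      show "cap (axis 1 1) s \<union> B \<in> sets lebesgue"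
        by (intro sets.Un fmeasurableD cap_lmeasurable) (simp add: B_def)
      show "cap (axis 1 1) s' \<union> L \<in> lmeasurable"
        unfolding L_def by (intro fmeasurable.Un cap_lmeasurable) auto
    qed
    also have "\<dots> \<le> measure lebesgue (cap (axis 1 1) s') + measure lebesgue L"
      by (rule measure_Un_le) (auto simp: L_def cap_lmeasurable fmeasurableD)
    also have "measure lebesgue L = 0"
      unfolding L_def using r by (subst box_2_measure) auto
    finally have "measure lebesgue (cap (axis 1 1) s) + measure lebesgue B \<le> measure lebesgue (cap (axis 1 1) s')"
      by simp
    moreover have "measure lebesgue B = (s - s') * (2 * r)"
      unfolding B_def using False r by (subst box_2_measure) auto
    ultimately show ?thesis by (simp add: r_def algebra_simps)
  qed
qed

lemma measure_cap_le:
  assumes "norm u = 1" "0 \<le> s" "s \<le> 1" "0 \<le> s'" "s' \<le> 1"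
  shows "measure lebesgue (cap u s) \<le> measure lebesgue (cap u s') + 2 * sqrt (1 - s\<^sup>2) * (s' - s)"
proof -
  have "norm (axis 1 1 :: real^2) = 1" by simp
  then obtain f :: "real^2 \<Rightarrow> real^2" where f: "orthogonal_transformation f" "f (axis 1 1) = u"
    using assms(1) by (rule orthogonal_transformation_exists_1)
  have "measure lebesgue (cap u t) = measure lebesgue (cap (axis 1 1) t)" for t
    using measure_orthogonal_image[OF f(1) cap_lmeasurable, of "axis 1 1" t]
    by (simp add: orthogonal_image_cap[OF f(1)] f(2))
  then show ?thesis using measure_cap_axis_le[OF assms(2-)] by simp
qed

lemma translate_cap: "(+) c ` cap u s = cball c 1 \<inter> {p. u \<bullet> p > u \<bullet> c + s}"
proof (intro equalityI subsetI)
  fix p assume p: "p \<in> cball c 1 \<inter> {p. u \<bullet> p > u \<bullet> c + s}"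
  then have "p - c \<in> cap u s" by (auto simp: cap_def inner_diff_right dist_norm norm_minus_commute)
  then have "c + (p - c) \<in> (+) c ` cap u s" by (rule imageI)
  then show "p \<in> (+) c ` cap u s" by simp
qed (auto simp: cap_def inner_add_right dist_norm)

lemma measure_cball_halfplane:
  "measure lebesgue (cball c 1 \<inter> {p. u \<bullet> p > h}) = measure lebesgue (cap u (h - u \<bullet> c))"
proof -
  have "cball c 1 \<inter> {p. u \<bullet> p > h} = (+) c ` cap u (h - u \<bullet> c)"
    by (subst translate_cap) simp
  then show ?thesis by (simp add: measure_translation)
qed

lemma cball_halfplane_lmeasurable: "cball c 1 \<inter> {p :: real^2. u \<bullet> p > h} \<in> lmeasurable"
  by (intro fmeasurable_Int_fmeasurable) (auto simp: open_halfspace_gt)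

text \<open>If \<open>u\<close> is the unit outer normal of a chord at distance \<open>s\<close> from the centre, then \<open>f\<close> bounds the
  area of the cap cut off from the disk with moving centre \<open>c t\<close>, with equality at \<open>t = 0\<close>; a
  bound suffices because \<open>t = 0\<close> will be a minimum of the gap.\<close>

lemma cap_area_bound:
  fixes c :: "real \<Rightarrow> real^2"
  assumes u: "norm u = 1" and h: "0 < h - u \<bullet> c 0" "h - u \<bullet> c 0 < 1"
    and c: "(c has_vector_derivative c') (at 0)"
  obtains f where
    "\<forall>\<^sub>F t in at 0. measure lebesgue (cball (c t) 1 \<inter> {p. u \<bullet> p > h})
        \<le> measure lebesgue (cball (c 0) 1 \<inter> {p. u \<bullet> p > h}) + f t"
    "f 0 = 0" "(f has_real_derivative 2 * sqrt (1 - (h - u \<bullet> c 0)\<^sup>2) * (u \<bullet> c')) (at 0)"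
proof
  define s where "s t = h - u \<bullet> c t" for t
  \<comment> \<open>An upper bound for the cap at height \<open>s t\<close> needs the tangent at
    this moving height. The factor \<open>s 0 - s t\<close> vanishes at time 0, so the derivative of
    the square root does not contribute there.\<close>
  define f where "f t = 2 * sqrt (1 - (s t)\<^sup>2) * (s 0 - s t)" for t
  have s': "(s has_real_derivative - (u \<bullet> c')) (at 0)"
    using c unfolding s_def has_real_derivative_iff_has_vector_derivative
    by (auto intro!: derivative_eq_intros bounded_linear.has_vector_derivative[OF bounded_linear_inner_right])
  have "isCont s 0" using s' by (rule DERIV_isCont)
  then have lim: "(s \<longlongrightarrow> s 0) (at 0)" by (simp add: isCont_def)
  have "\<forall>\<^sub>F t in at 0. s t > 0" "\<forall>\<^sub>F t in at 0. s t < 1"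
    using order_tendstoD[OF lim] h by (auto simp only: s_def)
  then show "\<forall>\<^sub>F t in at 0. measure lebesgue (cball (c t) 1 \<inter> {p. u \<bullet> p > h})
        \<le> measure lebesgue (cball (c 0) 1 \<inter> {p. u \<bullet> p > h}) + f t"
  proof eventually_elim
    case (elim t)
    then show ?case
      using measure_cap_le[OF u, of "s t" "s 0"] h unfolding measure_cball_halfplane f_def
      by (simp add: s_def)
  qed
  show "f 0 = 0" by (simp add: f_def)
  have "1 - (s 0)\<^sup>2 > 0" using h by (simp add: s_def abs_square_less_1)
  then show "(f has_real_derivative 2 * sqrt (1 - (h - u \<bullet> c 0)\<^sup>2) * (u \<bullet> c')) (at 0)"
    unfolding f_def using s' by (auto intro!: derivative_eq_intros simp: s_def[symmetric])
qed

section \<open>Orientation in oblique coordinates\<close>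

lemma cross_expand:
  assumes "cross e f \<noteq> 0"
  shows "z = (cross z f / cross e f) *\<^sub>R e + (cross e z / cross e f) *\<^sub>R f"
proof -
  have "cross e f *\<^sub>R z = cross z f *\<^sub>R e + cross e z *\<^sub>R f"
    by (simp add: vec_eq_2 cross_def algebra_simps)
  also have "\<dots> = cross e f *\<^sub>R ((cross z f / cross e f) *\<^sub>R e + (cross e z / cross e f) *\<^sub>R f)"
    using assms by (simp add: scaleR_add_right)
  finally show ?thesis using assms by (simp only: scaleR_cancel_left) auto
qed

lemma orient_combination:
  assumes "p - c = a *\<^sub>R (q - c) + b *\<^sub>R (r - c)"
  shows "orient q r p = cross (q - c) (r - c) * (1 - a - b)"
proof -
  have "p = c + a *\<^sub>R (q - c) + b *\<^sub>R (r - c)" using assms by (simp add: algebra_simps)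
  then show ?thesis by (simp add: orient_def cross_def) (simp add: algebra_simps)
qed

lemma orient_affine: "orient a b ((1 - t) *\<^sub>R p + t *\<^sub>R q) = (1 - t) * orient a b p + t * orient a b q"
  by (simp add: orient_def algebra_simps)

subsection \<open>Decomposition of a Reuleaux polygon into a polygon and caps\<close>

context reuleaux_ccw begin

abbreviation "e j \<equiv> X (j + k) - X j"
abbreviation "f j \<equiv> X (j + (k + 1)) - X j"

text \<open>Positive on the side of the chord that contains \<open>X j\<close>, negative beyond the
  chord, where the cap about \<open>X j\<close> lies.\<close>

definition side :: "nat \<Rightarrow> real^2 \<Rightarrow> real" where
  "side j p = orient (X (j + k)) (X (j + (k + 1))) p"

lemma norm_ef [simp]: "norm (e j) = 1" "norm (X (Suc (j + k)) - X j) = 1"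
  using dist_X_k[of j] by (simp_all add: dist_norm norm_minus_commute)

lemma cross_ef_pos: "cross (e j) (f j) > 0"
  using orient_X_pos[of k "k + 1" j] n n_pos by (simp add: orient_eq_cross)

text \<open>The points \<open>p\<close>, \<open>q\<close> are at distance at most 1 and both at
  distance 1 from \<open>c\<close>, so they are seen from \<open>c\<close> under an angle of at most
  \<pi>/3.\<close>

lemma inner_ge_half:
  assumes "p \<in> R" "q \<in> R" "norm (p - c) = 1" "norm (q - c) = 1"
  shows "(p - c) \<bullet> (q - c) \<ge> 1 / 2"
proof -
  have "norm ((p - c) - (q - c)) \<le> 1"
    using constant_width_dist_le[OF constant_width assms(1,2)] by (simp add: dist_norm)
  then have "((p - c) - (q - c)) \<bullet> ((p - c) - (q - c)) \<le> 1"
    by (simp add: norm_le_square power2_eq_square dot_square_norm abs_square_le_1)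
  moreover have "(p - c) \<bullet> (p - c) = 1" "(q - c) \<bullet> (q - c) = 1" using assms unfolding norm_eq_1 by auto
  ultimately show ?thesis
    by (simp only: inner_diff_left[of "p - c" "q - c"] inner_diff_right[of _ "p - c" "q - c"] inner_commute[of "q - c" "p - c"])
qed

lemma coordinates:
  obtains a b where "p - X j = a *\<^sub>R e j + b *\<^sub>R f j" "side j p = cross (e j) (f j) * (1 - a - b)"
proof -
  obtain a b where ab: "p - X j = a *\<^sub>R e j + b *\<^sub>R f j"
    using cross_expand[of "e j" "f j" "p - X j"] cross_ef_pos[of j] by fastforce
  show ?thesis using that[OF ab] orient_combination[OF ab] by (simp add: side_def)
qed

lemma dist_X_R: "p \<in> R \<Longrightarrow> dist p (X i) \<le> 1"
  by (simp add: R_iff)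

lemma normal_at: "q \<in> R \<Longrightarrow> dist q (X i) = 1 \<Longrightarrow> unit_outer_normal R q (q - X i)"
  by (rule unit_outer_normal_diff) (auto simp: R_iff)

text \<open>The unit normals at \<open>X j\<close> include \<open>- e j\<close> and \<open>- f j\<close>, hence everything in between.\<close>

lemma arc_subset_R:
  assumes "norm (a *\<^sub>R e j + b *\<^sub>R f j) = 1" "a \<ge> 0" "b \<ge> 0"
  shows "X j + (a *\<^sub>R e j + b *\<^sub>R f j) \<in> R"
proof -
  have n: "unit_outer_normal R (X j) (- e j)" "unit_outer_normal R (X j) (- f j)"
    using unit_outer_normal_diff[of R "X (j + k)" "X j"] unit_outer_normal_diff[of R "X (j + (k + 1))" "X j"]
      dist_X_k[of j] by (auto simp: R_iff)
  have "unit_outer_normal R (X j) (a *\<^sub>R (- e j) + b *\<^sub>R (- f j))"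
    using assms(1) by (intro unit_outer_normal_combination n assms(2,3)) (metis (no_types, lifting) minus_add_distrib norm_minus_cancel scaleR_minus_right)
  then have "X j - (a *\<^sub>R (- e j) + b *\<^sub>R (- f j)) \<in> R"
    by (intro constant_width_minus_normal constant_width) auto
  moreover have "X j - (a *\<^sub>R (- e j) + b *\<^sub>R (- f j)) = X j + (a *\<^sub>R e j + b *\<^sub>R f j)"
    by (simp add: algebra_simps)
  ultimately show ?thesis by metis
qed

text \<open>The coordinates of \<open>p\<close> along \<open>e j\<close> and \<open>f j\<close> are
  nonnegative: a negative one would, by the triangle inequality, push \<open>p\<close> out of the
  disk. Hence the ray from \<open>X j\<close> through \<open>p\<close> meets the chord before or at
  \<open>p\<close> and the arc after or at it, at parameters \<open>1 / (a + b)\<close> and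
  \<open>1 / norm z\<close>. Both points are in \<open>R\<close>, and convexity gives
  \<open>p\<close>.\<close>

lemma cap_subset_R:
  assumes "dist p (X j) \<le> 1" "side j p < 0"
  shows "p \<in> R"
proof -
  define E where "E = e j" define F where "F = f j"
  have EF: "norm E = 1" "norm F = 1" by (simp_all add: E_def F_def)
  obtain a b where ab: "p - X j = a *\<^sub>R E + b *\<^sub>R F" "side j p = cross E F * (1 - a - b)"
    using coordinates E_def F_def by metis
  have s: "a + b > 1" using ab(2) assms(2) cross_ef_pos[of j] by (auto simp: E_def F_def mult_less_0_iff)
  define z where "z = p - X j"
  have z: "norm z \<le> 1" using assms(1) by (simp add: z_def dist_norm)
  have "a \<ge> 0"
  proof (rule ccontr)
    assume "\<not> a \<ge> 0"
    have "b *\<^sub>R F = z - a *\<^sub>R E" using ab by (simp add: z_def)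
    then have "norm (b *\<^sub>R F) \<le> norm z + norm (a *\<^sub>R E)" by (metis norm_triangle_ineq4)
    then show False using z s EF \<open>\<not> a \<ge> 0\<close> by simp
  qed
  have "b \<ge> 0"
  proof (rule ccontr)
    assume "\<not> b \<ge> 0"
    have "a *\<^sub>R E = z - b *\<^sub>R F" using ab by (simp add: z_def)
    then have "norm (a *\<^sub>R E) \<le> norm z + norm (b *\<^sub>R F)" by (metis norm_triangle_ineq4)
    then show False using z s EF \<open>\<not> b \<ge> 0\<close> by simp
  qed
  have z0: "z \<noteq> 0"
  proof
    assume "z = 0"
    then have "a *\<^sub>R E = - (b *\<^sub>R F)" using ab(1) by (simp add: z_def eq_neg_iff_add_eq_0)
    moreover have "cross (a *\<^sub>R E) F = a * cross E F" "cross (- (b *\<^sub>R F)) F = 0"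
      "cross E (b *\<^sub>R F) = b * cross E F" "cross E (- (a *\<^sub>R E)) = 0"
      by (simp_all add: cross_def algebra_simps)
    ultimately have "a * cross E F = 0" by metis
    moreover have "b *\<^sub>R F = - (a *\<^sub>R E)" using \<open>a *\<^sub>R E = - (b *\<^sub>R F)\<close> by simp
    then have "b * cross E F = 0" using \<open>cross E (b *\<^sub>R F) = b * cross E F\<close> \<open>cross E (- (a *\<^sub>R E)) = 0\<close> by metis
    ultimately show False using s cross_ef_pos[of j] by (auto simp: E_def F_def)
  qed
  have eq: "r *\<^sub>R z = (r * a) *\<^sub>R E + (r * b) *\<^sub>R F" for r
    using ab(1) by (simp add: z_def scaleR_add_right)
  have q1: "X j + (1 / norm z) *\<^sub>R z \<in> R"
    using arc_subset_R[of "1 / norm z * a" j "1 / norm z * b"] \<open>a \<ge> 0\<close> \<open>b \<ge> 0\<close> z0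
      eq[of "1 / norm z", symmetric] by (simp add: E_def F_def)
  have q0: "X j + (1 / (a + b)) *\<^sub>R z \<in> R"
  proof -
    have "(a / (a + b)) *\<^sub>R X (j + k) + (b / (a + b)) *\<^sub>R X (j + (k + 1)) \<in> R"
      using \<open>a \<ge> 0\<close> \<open>b \<ge> 0\<close> s by (intro convexD[OF convex_R]) (auto simp: add_divide_distrib[symmetric])
    also have "(a / (a + b)) *\<^sub>R X (j + k) + (b / (a + b)) *\<^sub>R X (j + (k + 1))
        = ((a / (a + b)) *\<^sub>R E + (b / (a + b)) *\<^sub>R F) + (a / (a + b) + b / (a + b)) *\<^sub>R X j"
      by (simp add: E_def F_def algebra_simps)
    also have "a / (a + b) + b / (a + b) = 1" using s by (simp add: add_divide_distrib[symmetric])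
    finally show ?thesis using eq[of "1 / (a + b)"] by (simp add: add.commute)
  qed
  define r where "r = 1 / (a + b)"
  define t where "t = 1 / norm z"
  have rt: "r < 1" "1 \<le> t" using s z z0 by (auto simp: r_def t_def)
  have "((t - 1) / (t - r)) *\<^sub>R (X j + r *\<^sub>R z) + ((1 - r) / (t - r)) *\<^sub>R (X j + t *\<^sub>R z) \<in> R"
    using rt q0 q1 by (intro convexD[OF convex_R]) (auto simp: r_def t_def add_divide_distrib[symmetric])
  also have "((t - 1) / (t - r)) *\<^sub>R (X j + r *\<^sub>R z) + ((1 - r) / (t - r)) *\<^sub>R (X j + t *\<^sub>R z)
      = ((t - 1) / (t - r) + (1 - r) / (t - r)) *\<^sub>R X j
        + ((t - 1) / (t - r) * r + (1 - r) / (t - r) * t) *\<^sub>R z"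
    by (simp add: algebra_simps)
  also have "(t - 1) / (t - r) + (1 - r) / (t - r) = 1" using rt by (simp add: add_divide_distrib[symmetric])
  also have "(t - 1) / (t - r) * r + (1 - r) / (t - r) * t = (t - r) / (t - r)"
    by (simp add: algebra_simps add_divide_distrib[symmetric] diff_divide_distrib[symmetric])
  also have "(t - r) / (t - r) = 1" using rt by simp
  finally show ?thesis by (simp add: z_def)
qed

text \<open>If a point of the circle about \<open>X j\<close> lies in \<open>R\<close> but beyond \<open>X (j + k)\<close> or
  \<open>X (j + k + 1)\<close>, then that vertex has only one unit normal.\<close>

lemma arc_end_normal:
  assumes "m \<in> vertices R" "norm (m - X j) = 1" "p \<in> R" "q \<in> R" "norm (p - X j) = 1" "norm (q - X j) = 1"
    and m: "m - X j = a *\<^sub>R (p - X j) + b *\<^sub>R (q - X j)" "a \<ge> 0" "b \<ge> 0" "a + b > 1"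
  shows False
proof -
  have mR: "m \<in> R" using assms(1) vertices_subset[OF closed_R] by auto
  have "u = m - X j" if u: "unit_outer_normal R m u" for u
  proof (rule unit_combination_eq[OF assms(5,6,2) _ m])
    have "m - u \<in> R" by (rule constant_width_minus_normal[OF constant_width mR u])
    then have "dist (m - u) p \<le> 1" "dist (m - u) q \<le> 1"
      using constant_width_dist_le[OF constant_width] assms by auto
    then show "dist (m - X j - u) (p - X j) \<le> 1" "dist (m - X j - u) (q - X j) \<le> 1"
      by (simp_all add: dist_norm algebra_simps)
  qed (use u in \<open>simp add: unit_outer_normal_def\<close>)
  then show False using assms(1) by (auto simp: vertices_def)
qed

text \<open>Otherwise \<open>Q\<close> has coordinates with \<open>a + b < 1\<close>. If both are
  nonnegative, \<open>Q\<close> is shorter than 1; if both are nonpositive, its angle with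
  \<open>e j\<close> exceeds \<pi>/3; if the signs differ, one end of the arc lies strictly between
  \<open>q\<close> and the other end, so it has only one normal and is no vertex.\<close>

lemma side_arc_le:
  assumes "q \<in> R" "dist q (X j) = 1"
  shows "side j q \<le> 0"
proof (rule ccontr)
  assume pos: "\<not> side j q \<le> 0"
  define E where "E = e j" define F where "F = f j"
  define Q where "Q = q - X j"
  have n1: "norm E = 1" "norm F = 1" "norm Q = 1"
    using assms(2) by (simp_all add: E_def F_def Q_def dist_norm)
  obtain a b where ab: "Q = a *\<^sub>R E + b *\<^sub>R F" "side j q = cross E F * (1 - a - b)"
    using coordinates E_def F_def Q_def by metis
  have s: "a + b < 1" using ab(2) pos cross_ef_pos[of j] by (auto simp: E_def F_def not_le zero_less_mult_iff)
  have V: "X (j + k) \<in> vertices R" "X (j + (k + 1)) \<in> vertices R" by auto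
  consider "a \<ge> 0" "b \<ge> 0" | "a \<le> 0" "b \<le> 0" | "a < 0" "b > 0" | "a > 0" "b < 0" by argo
  then show False
  proof cases
    case 1
    have "norm Q \<le> norm (a *\<^sub>R E) + norm (b *\<^sub>R F)" unfolding ab(1) by (rule norm_triangle_ineq)
    then show False using n1 1 s by simp
  next
    case 3
    have "F = (1 / b) *\<^sub>R (Q - a *\<^sub>R E)" using ab(1) 3 by simp
    also have "\<dots> = (1 / b) *\<^sub>R Q + (- a / b) *\<^sub>R E" by (simp add: scaleR_diff_right)
    finally show False
      unfolding Q_def E_def F_def
      by (rule arc_end_normal[OF V(2) _ assms(1), rotated 4])
        (use 3 s n1(3) in \<open>simp_all add: field_simps Q_def\<close>)
  next
    case 4
    have "E = (1 / a) *\<^sub>R (Q - b *\<^sub>R F)" using ab(1) 4 by simp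
    also have "\<dots> = (1 / a) *\<^sub>R Q + (- b / a) *\<^sub>R F" by (simp add: scaleR_diff_right)
    finally show False
      unfolding Q_def E_def F_def
      by (rule arc_end_normal[OF V(1) _ assms(1), rotated 4])
        (use 4 s n1(3) in \<open>simp_all add: field_simps Q_def\<close>)
  next
    case 2
    have "1/2 \<le> Q \<bullet> E" "1/2 \<le> E \<bullet> F"
      unfolding Q_def E_def F_def using assms norm_ef[of j] by (intro inner_ge_half; simp add: dist_norm)+
    moreover have "Q \<bullet> E = a * (E \<bullet> E) + b * (E \<bullet> F)"
      by (simp add: ab(1) inner_add_left inner_commute[of F E])
    moreover have "E \<bullet> E = 1" using n1(1) by (simp add: norm_eq_1)
    moreover have "b * (E \<bullet> F) \<le> 0"
      using 2 \<open>1/2 \<le> E \<bullet> F\<close> by (intro mult_nonpos_nonneg) auto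
    ultimately show False using 2 by simp
  qed
qed

lemma side_X: "side j (X m) \<ge> 0" "X m \<noteq> X (j + k) \<Longrightarrow> X m \<noteq> X (j + (k + 1)) \<Longrightarrow> side j (X m) > 0"
proof -
  obtain c where c: "c < n" "X m = X (j + k + c)"
  proof
    define c where "c = (m + (n - (j + k) mod n)) mod n"
    have "(j + k + c) mod n = ((j + k) mod n + (m + (n - (j + k) mod n))) mod n"
      by (simp add: c_def mod_add_left_eq mod_add_right_eq)
    also have "(j + k) mod n + (m + (n - (j + k) mod n)) = m + n"
      using n_pos mod_less_divisor[of n "j + k"] by linarith
    finally show "X m = X (j + k + c)" by (simp add: X_eq_iff)
    show "c < n" using n_pos by (simp add: c_def)
  qed
  have *: "side j (X m) > 0" if "c > 1"
    using orient_X_pos[of 1 c "j + k"] that c by (simp add: side_def)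
  consider "c = 0" | "c = 1" | "c > 1" by linarith
  then show "side j (X m) \<ge> 0"
    by cases (use * c in \<open>auto simp: side_def orient_def\<close>)
  show "side j (X m) > 0" if "X m \<noteq> X (j + k)" "X m \<noteq> X (j + (k + 1))"
    using that c * by (cases "c > 1") (auto simp: not_less le_Suc_eq)
qed

text \<open>The outward unit normal of the chord. The quarter turn of an edge traversed
  counter-clockwise points inward, hence the minus sign.\<close>

definition u :: "nat \<Rightarrow> real^2" where
  "u j = - perp (X (j + (k + 1)) - X (j + k)) /\<^sub>R dist (X (j + k)) (X (j + (k + 1)))"

definition h :: "nat \<Rightarrow> real" where "h j = u j \<bullet> X (j + k)"

lemma chord_pos: "dist (X (j + k)) (X (j + (k + 1))) > 0"
proof -
  have "e j \<noteq> f j" using cross_ef_pos[of j] by (auto simp: cross_def)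
  then show ?thesis by simp
qed

lemma norm_u: "norm (u j) = 1"
  using chord_pos[of j] by (simp add: u_def dist_norm norm_minus_commute)

lemma side_eq: "side j p = dist (X (j + k)) (X (j + (k + 1))) * (h j - u j \<bullet> p)"
proof -
  have "dist (X (j + k)) (X (j + (k + 1))) * (u j \<bullet> q) = - perp (X (j + (k + 1)) - X (j + k)) \<bullet> q" for q
    using chord_pos[of j] by (simp add: u_def)
  then show ?thesis
    by (simp only: h_def right_diff_distrib) (simp add: side_def orient_def inner_2 algebra_simps)
qed

lemma side_neg_iff: "side j p < 0 \<longleftrightarrow> u j \<bullet> p > h j"
  unfolding side_eq using chord_pos[of j] by (simp add: mult_less_0_iff)

text \<open>Base point of the radial arguments below. The affine function \<open>side j\<close> is
  nonnegative at all vertices and positive at some, so it is positive at their mean.\<close>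

definition centre :: "real^2" where "centre = (1 / real n) *\<^sub>R (\<Sum>i<n. X i)"

lemma centre_in_R: "centre \<in> R"
proof -
  have "(\<Sum>i<n. (1 / real n) *\<^sub>R X i) \<in> R"
    using n_pos by (intro convex_sum convex_R) auto
  then show ?thesis by (simp add: centre_def scaleR_sum_right)
qed

lemma side_centre_pos: "side j centre > 0"
proof -
  define d where "d = dist (X (j + k)) (X (j + (k + 1)))"
  have "real n * side j centre = (\<Sum>i<n. side j (X i))"
    using n_pos by (simp add: side_eq d_def[symmetric] centre_def inner_sum_right
        sum_subtractf sum_distrib_left[symmetric] right_diff_distrib)
  also have "(\<Sum>i<n. side j (X i)) > 0"
  proof (rule sum_pos2)
    define m where "m = (j + k + 2) mod n"
    show "m \<in> {..<n}" using n_pos by (simp add: m_def)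
    have "X m = X (j + k + 2)" by (simp add: X_eq_iff m_def)
    then show "0 < side j (X m)"
      using orient_X_pos[of 1 2 "j + k"] n(3) by (simp add: side_def)
  qed (auto simp: side_X)
  finally show ?thesis using n_pos by (simp add: zero_less_mult_iff)
qed

lemma frontier_side:
  assumes "q \<in> frontier R"
  shows "\<exists>l. side l q \<le> 0"
proof -
  have fin: "finite (range X)" using vertices_range reuleaux_polygon_centres(2)[OF R] by simp
  have "q \<in> R" using assms closed_R frontier_subset_closed by blast
  moreover obtain l where "dist q (X l) = 1"
    using frontier_disk_intersection[OF fin] assms R_eq by auto
  ultimately show ?thesis using side_arc_le by blast
qed

lemma segment_meets_frontier:
  assumes "a \<in> R" "b \<notin> R"
  obtains t where "0 \<le> t" "t \<le> 1" "(1 - t) *\<^sub>R a + t *\<^sub>R b \<in> frontier R"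
proof -
  have "closed_segment a b \<inter> frontier R \<noteq> {}"
    using assms by (intro connected_Int_frontier) auto
  then show ?thesis using that by (auto simp: closed_segment_def)
qed

text \<open>On the way from \<open>centre\<close> to a point outside \<open>R\<close> the segment
  crosses the frontier, where some \<open>side l\<close> is at most 0. Being affine,
  \<open>side l\<close> is positive at \<open>centre\<close> and on the whole segment before
  \<open>p\<close> if it is nonnegative at \<open>p\<close>.\<close>

lemma inner_polygon_subset:
  assumes "\<And>l. side l p \<ge> 0"
  shows "p \<in> R"
proof (rule ccontr)
  assume "p \<notin> R"
  then obtain t where t: "0 \<le> t" "t \<le> 1" "(1 - t) *\<^sub>R centre + t *\<^sub>R p \<in> frontier R"
    using segment_meets_frontier[OF centre_in_R] by blast
  then have "t \<noteq> 1" using \<open>p \<notin> R\<close> closed_R frontier_subset_closed by force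
  obtain l where "side l ((1 - t) *\<^sub>R centre + t *\<^sub>R p) \<le> 0" using frontier_side[OF t(3)] by auto
  then have "(1 - t) * side l centre + t * side l p \<le> 0" by (simp add: side_def orient_affine)
  moreover have "(1 - t) * side l centre > 0" using side_centre_pos t \<open>t \<noteq> 1\<close> by simp
  moreover have "t * side l p \<ge> 0" using t assms by simp
  ultimately show False by linarith
qed

text \<open>A point in two caps could be pushed away from \<open>centre\<close> to the boundary of \<open>R\<close>, to
  lie on both circles, hence be a vertex; but no vertex lies in the interior of a cap.\<close>

lemma caps_disjoint:
  assumes "X i \<noteq> X j" "p \<in> R" "side i p < 0" "side j p < 0"
  shows False
proof -
  have "p \<noteq> centre" using assms(3) side_centre_pos[of i] by auto
  then have d: "dist p centre > 0" "dist p centre \<le> 1"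
    using constant_width_dist_le[OF constant_width assms(2) centre_in_R] by auto
  \<comment> \<open>This scaling puts \<open>b\<close> on the ray from \<open>centre\<close> through
    \<open>p\<close> at distance 2 from \<open>centre\<close>, hence outside
    \<open>R\<close>.\<close>
  define T where "T = 2 / dist p centre"
  have T: "T \<ge> 1" using d by (simp add: T_def)
  define b where "b = (1 - T) *\<^sub>R centre + T *\<^sub>R p"
  have "b - centre = T *\<^sub>R (p - centre)" by (simp add: b_def algebra_simps)
  then have "dist b centre = 2" using d T by (simp add: dist_norm T_def)
  then have "b \<notin> R" using constant_width_dist_le[OF constant_width _ centre_in_R, of b] by auto
  then obtain t where t: "0 \<le> t" "t \<le> 1" "(1 - t) *\<^sub>R p + t *\<^sub>R b \<in> frontier R"
    using segment_meets_frontier[OF assms(2)] by blast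
  define q where "q = (1 - t) *\<^sub>R p + t *\<^sub>R b"
  have qR: "q \<in> R" using t closed_R frontier_subset_closed by (force simp: q_def)
  \<comment> \<open>\<open>side l\<close> is affine and positive at \<open>centre\<close>, so once
    negative it stays negative further along the ray.\<close>
  have neg: "side l q < 0" if "side l p < 0" for l
  proof -
    have "(1 - T) * side l centre \<le> 0" using T side_centre_pos[of l] by (simp add: mult_nonpos_nonneg)
    moreover have "T * side l p < 0" using T that by (simp add: mult_less_0_iff)
    ultimately have "side l b < 0" unfolding b_def side_def orient_affine by simp
    moreover have "side l q = (1 - t) * side l p + t * side l b" by (simp add: q_def side_def orient_affine)
    moreover have "(1 - t) * side l p + t * side l b < 0"
    proof (cases "t = 0")
      case False
      then show ?thesis using t that \<open>side l b < 0\<close>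
        by (intro add_nonpos_neg) (auto simp: mult_less_0_iff mult_le_0_iff)
    qed (use that in simp)
    ultimately show ?thesis by simp
  qed
  \<comment> \<open>The part of cap \<open>l\<close> strictly inside its disk is an open subset of
    \<open>R\<close>, so it contains no frontier point.\<close>
  have on: "dist q (X l) = 1" if "side l p < 0" for l
  proof (rule ccontr)
    assume "dist q (X l) \<noteq> 1"
    then have "q \<in> ball (X l) 1" using dist_X_R[OF qR, of l] by (simp add: dist_commute)
    have "open (ball (X l) 1 \<inter> {p. u l \<bullet> p > h l})"
      by (intro open_Int open_ball open_halfspace_gt)
    moreover have "q \<in> ball (X l) 1 \<inter> {p. u l \<bullet> p > h l}"
      using \<open>q \<in> ball (X l) 1\<close> neg[OF that] by (simp add: side_neg_iff)
    moreover have "ball (X l) 1 \<inter> {p. u l \<bullet> p > h l} \<subseteq> R"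
      using cap_subset_R[of _ l] by (auto simp: side_neg_iff dist_commute less_imp_le)
    ultimately have "q \<in> interior R" by (rule interiorI)
    then show False using t(3) by (simp add: q_def frontier_def)
  qed
  have "q \<in> vertices R"
    by (rule verticesI[OF qR normal_at[OF qR on[OF assms(3)]] normal_at[OF qR on[OF assms(4)]]])
      (use assms(1) in simp)
  then obtain m where "q = X m" by (auto simp: vertices_range)
  then show False using neg[OF assms(3)] side_X(1)[of i m] by simp
qed

lemma side_mod: "side (j mod n) p = side j p"
proof -
  have "X (j mod n + c) = X (j + c)" for c by (simp add: X_eq_iff mod_add_left_eq)
  then show ?thesis by (simp only: side_def)
qed

subsection \<open>First variation of the area\<close>

definition inner_polygon :: "(real^2) set" where
  "inner_polygon = {p. \<forall>j<n. u j \<bullet> p \<le> h j}"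

abbreviation "outer j \<equiv> {p. u j \<bullet> p > h j}"

lemma inner_polygon_subset_R: "inner_polygon \<subseteq> R"
proof
  fix p assume p: "p \<in> inner_polygon"
  have "side l p \<ge> 0" for l
  proof -
    have "\<not> side (l mod n) p < 0"
      using p n_pos unfolding side_neg_iff by (auto simp: inner_polygon_def not_less)
    then show ?thesis by (simp add: side_mod)
  qed
  then show "p \<in> R" by (rule inner_polygon_subset)
qed

lemma bounded_R: "bounded R"
  using constant_width by (auto simp: constant_width_def compact_imp_bounded)

lemma lmeasurable_R: "R \<in> lmeasurable"
  using bounded_R closed_R by (simp add: bounded_set_imp_lmeasurable)

lemma inner_polygon_lmeasurable: "inner_polygon \<in> lmeasurable"
proof -
  have "inner_polygon = (\<Inter>j\<in>{..<n}. {p. u j \<bullet> p \<le> h j})" by (auto simp: inner_polygon_def)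
  then have "closed inner_polygon" by (simp only:) (intro closed_INT ballI closed_halfspace_le)
  then show ?thesis
    using bounded_subset[OF bounded_R inner_polygon_subset_R] by (simp add: bounded_set_imp_lmeasurable)
qed

lemma area_R_ge:
  "measure lebesgue inner_polygon + (\<Sum>j<n. measure lebesgue (cball (X j) 1 \<inter> outer j)) \<le> measure lebesgue R"
proof -
  let ?cap = "\<lambda>j. cball (X j) 1 \<inter> outer j"
  have caps: "(\<Sum>j<n. measure lebesgue (?cap j)) = measure lebesgue (\<Union>j\<in>{..<n}. ?cap j)"
  proof (rule measure_finite_Union[symmetric])
    show "disjoint_family_on ?cap {..<n}"
      unfolding disjoint_family_on_def
    proof (intro ballI impI equals0I)
      fix i j p assume ij: "i \<in> {..<n}" "j \<in> {..<n}" "i \<noteq> j" and p: "p \<in> ?cap i \<inter> ?cap j"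
      have "side i p < 0" "side j p < 0" using p by (auto simp: side_neg_iff)
      moreover have "p \<in> R" using p cap_subset_R[of p i] by (auto simp: side_neg_iff dist_commute)
      moreover have "X i \<noteq> X j" using ij by (simp add: X_eq_iff)
      ultimately show False using caps_disjoint by blast
    qed
    show "emeasure lebesgue (?cap j) \<noteq> \<infinity>" for j
      using fmeasurableD2[OF cball_halfplane_lmeasurable] unfolding infinity_ennreal_def .
  qed (auto intro: fmeasurableD cball_halfplane_lmeasurable)
  have "measure lebesgue inner_polygon + measure lebesgue (\<Union>j\<in>{..<n}. ?cap j)
      = measure lebesgue (inner_polygon \<union> (\<Union>j\<in>{..<n}. ?cap j))"
  proof (rule measure_Union[symmetric])
    have fm: "(\<Union>j\<in>{..<n}. ?cap j) \<in> lmeasurable"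
      by (intro fmeasurable.finite_UN) (auto simp: cball_halfplane_lmeasurable)
    show "emeasure lebesgue (\<Union>j\<in>{..<n}. ?cap j) \<noteq> \<infinity>" "(\<Union>j\<in>{..<n}. ?cap j) \<in> sets lebesgue"
      using fmeasurableD2[OF fm] fmeasurableD[OF fm] unfolding infinity_ennreal_def by auto
    show "inner_polygon \<inter> (\<Union>j\<in>{..<n}. ?cap j) = {}"
      by (auto simp: inner_polygon_def not_less[symmetric])
    show "emeasure lebesgue inner_polygon \<noteq> \<infinity>" "inner_polygon \<in> sets lebesgue"
      using fmeasurableD2[OF inner_polygon_lmeasurable] fmeasurableD[OF inner_polygon_lmeasurable]
      unfolding infinity_ennreal_def by auto
  qed
  also have "\<dots> \<le> measure lebesgue R"
  proof (rule measure_mono_fmeasurable)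
    show "inner_polygon \<union> (\<Union>j\<in>{..<n}. ?cap j) \<subseteq> R"
      using inner_polygon_subset_R cap_subset_R by (auto simp: side_neg_iff dist_commute)
    show "inner_polygon \<union> (\<Union>j\<in>{..<n}. ?cap j) \<in> sets lebesgue"
      using inner_polygon_lmeasurable cball_halfplane_lmeasurable
      by (intro sets.Un sets.finite_UN) (auto intro: fmeasurableD)
  qed (rule lmeasurable_R)
  finally show ?thesis unfolding caps .
qed

text \<open>A point of the intersection that is not in the inner polygon is beyond some chord
  \<open>j\<close> and still in the disk about \<open>c j\<close>. The centres are arbitrary;
  neither disjointness of the new caps nor constant width is involved.\<close>

lemma area_disk_intersection_le:
  "measure lebesgue (disk_intersection (c ` {..<n})) \<le>
    measure lebesgue inner_polygon + (\<Sum>j<n. measure lebesgue (cball (c j) 1 \<inter> outer j))"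
proof -
  let ?cap = "\<lambda>j. cball (c j) 1 \<inter> outer j"
  let ?D = "disk_intersection (c ` {..<n})"
  have fm: "(\<Union>j\<in>{..<n}. ?cap j) \<in> lmeasurable"
    by (intro fmeasurable.finite_UN) (auto simp: cball_halfplane_lmeasurable)
  have "measure lebesgue ?D \<le> measure lebesgue (inner_polygon \<union> (\<Union>j\<in>{..<n}. ?cap j))"
  proof (rule measure_mono_fmeasurable)
    show "?D \<subseteq> inner_polygon \<union> (\<Union>j\<in>{..<n}. ?cap j)"
      by (auto simp: inner_polygon_def disk_intersection_iff dist_commute not_le)
    show "?D \<in> sets lebesgue" using closed_disk_intersection by (auto simp: borel_closed)
  qed (intro fmeasurable.Un inner_polygon_lmeasurable fm)
  also have "\<dots> \<le> measure lebesgue inner_polygon + measure lebesgue (\<Union>j\<in>{..<n}. ?cap j)"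
    using inner_polygon_lmeasurable fm by (intro measure_Un_le fmeasurableD)
  also have "measure lebesgue (\<Union>j\<in>{..<n}. ?cap j) \<le> (\<Sum>j<n. measure lebesgue (?cap j))"
    by (intro measure_UNION_le) (auto intro: fmeasurableD cball_halfplane_lmeasurable)
  finally show ?thesis by simp
qed

text \<open>If \<alpha> is the angle of the arc at \<open>X j\<close>, its chord has length 2 sin
  (\<alpha>/2) and is at distance cos (\<alpha>/2) from \<open>X j\<close>. Thus the factor in the
  derivative of the cap bound is the length of the chord.\<close>

lemma chord_distance:
  "0 < h j - u j \<bullet> X j" "h j - u j \<bullet> X j < 1"
  "2 * sqrt (1 - (h j - u j \<bullet> X j)\<^sup>2) = dist (X (j + k)) (X (j + (k + 1)))"
proof -
  define l where "l = dist (X (j + k)) (X (j + (k + 1)))"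
  have l: "l > 0" using chord_pos by (simp add: l_def)
  define s where "s = h j - u j \<bullet> X j"
  have "l * s = cross (e j) (f j)"
    using side_eq[of j "X j"] by (simp add: l_def s_def side_def orient_def cross_def algebra_simps)
  then have "s > 0" using l cross_ef_pos[of j] by (metis zero_less_mult_pos)
  then show "0 < h j - u j \<bullet> X j" by (simp add: s_def)
  define E where "E = e j" define F where "F = f j"
  have EF: "E$1 * E$1 + E$2 * E$2 = 1" "F$1 * F$1 + F$2 * F$2 = 1"
    using norm_ef[of j] unfolding norm_eq_1 inner_2 E_def F_def by auto
  have "l\<^sup>2 = (F - E) \<bullet> (F - E)"
    unfolding power2_norm_eq_inner[symmetric] by (simp add: l_def E_def F_def dist_norm norm_minus_commute)
  then have l2: "l\<^sup>2 = 2 - 2 * (E \<bullet> F)" using EF by (simp add: inner_2 algebra_simps)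
  have "(cross E F)\<^sup>2 + (E \<bullet> F)\<^sup>2 = (E$1 * E$1 + E$2 * E$2) * (F$1 * F$1 + F$2 * F$2)"
    by (simp add: cross_def inner_2 power2_eq_square algebra_simps)
  then have c2: "(cross E F)\<^sup>2 = (1 - E \<bullet> F) * (1 + E \<bullet> F)" using EF by (simp add: power2_eq_square algebra_simps)
  have "l\<^sup>2 * (4 * s\<^sup>2) = l\<^sup>2 * (4 - l\<^sup>2)"
  proof -
    have "l\<^sup>2 * (4 * s\<^sup>2) = 4 * (cross E F)\<^sup>2"
      using \<open>l * s = cross (e j) (f j)\<close> by (simp add: E_def F_def power_mult_distrib[symmetric])
    also have "\<dots> = l\<^sup>2 * (4 - l\<^sup>2)" unfolding c2 l2 by (simp add: algebra_simps)
    finally show ?thesis .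
  qed
  then have s2: "4 * s\<^sup>2 = 4 - l\<^sup>2" using l by simp
  moreover have "l\<^sup>2 > 0" using l by simp
  ultimately have "s\<^sup>2 < 1\<^sup>2" unfolding power_one by linarith
  then have "s < 1" by (rule power2_less_imp_less) simp
  then show "h j - u j \<bullet> X j < 1" by (simp add: s_def)
  have "1 - s\<^sup>2 = (l / 2)\<^sup>2" using s2 by (simp add: power_divide)
  then have "sqrt (1 - s\<^sup>2) = l / 2" using l by simp
  then show "2 * sqrt (1 - (h j - u j \<bullet> X j)\<^sup>2) = dist (X (j + k)) (X (j + (k + 1)))"
    by (simp add: s_def l_def)
qed

lemma area_first_variation:
  assumes c0: "\<And>j. j < n \<Longrightarrow> c j 0 = X j"
    and c': "\<And>j. j < n \<Longrightarrow> (c j has_vector_derivative c' j) (at 0)"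
    and A: "((\<lambda>t. measure lebesgue (disk_intersection ((\<lambda>j. c j t) ` {..<n}))) has_real_derivative 0) (at 0)"
  shows "(\<Sum>j<n. cross (c' j) (X (j + (k + 1)) - X (j + k))) = 0"
proof -
  let ?m = "measure lebesgue"
  let ?l = "\<lambda>j. dist (X (j + k)) (X (j + (k + 1)))"
  have "\<forall>j\<in>{..<n}. \<exists>g. (\<forall>\<^sub>F t in at 0. ?m (cball (c j t) 1 \<inter> outer j) \<le> ?m (cball (X j) 1 \<inter> outer j) + g t)
      \<and> g 0 = 0 \<and> (g has_real_derivative ?l j * (u j \<bullet> c' j)) (at 0)"
  proof
    fix j assume "j \<in> {..<n}" then have j: "j < n" by simp
    have deriv: "(c j has_vector_derivative c' j) (at 0)" using c'[OF j] .
    have "0 < h j - u j \<bullet> c j 0" "h j - u j \<bullet> c j 0 < 1" using chord_distance[of j] c0[OF j] by auto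
    then obtain g where "\<forall>\<^sub>F t in at 0. ?m (cball (c j t) 1 \<inter> outer j) \<le> ?m (cball (c j 0) 1 \<inter> outer j) + g t"
      "g 0 = 0" "(g has_real_derivative 2 * sqrt (1 - (h j - u j \<bullet> c j 0)\<^sup>2) * (u j \<bullet> c' j)) (at 0)"
      using deriv by (rule cap_area_bound[OF norm_u])
    then show "\<exists>g. (\<forall>\<^sub>F t in at 0. ?m (cball (c j t) 1 \<inter> outer j) \<le> ?m (cball (X j) 1 \<inter> outer j) + g t)
      \<and> g 0 = 0 \<and> (g has_real_derivative ?l j * (u j \<bullet> c' j)) (at 0)"
      unfolding c0[OF j] chord_distance(3) by (intro exI[of _ g] conjI)
  qed
  from bchoice[OF this] obtain g where g: "\<And>j. j < n \<Longrightarrow> \<forall>\<^sub>F t in at 0. ?m (cball (c j t) 1 \<inter> outer j) \<le> ?m (cball (X j) 1 \<inter> outer j) + g j t"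
    "\<And>j. j < n \<Longrightarrow> g j 0 = 0" "\<And>j. j < n \<Longrightarrow> (g j has_real_derivative ?l j * (u j \<bullet> c' j)) (at 0)"
    by blast
  define A where "A t = ?m (disk_intersection ((\<lambda>j. c j t) ` {..<n}))" for t
  define G where "G t = (\<Sum>j<n. g j t) - A t" for t
  have "R = disk_intersection (X ` {..<n})"
  proof -
    have "X ` {..<n} = range X" using vertices_eq vertices_range by (simp add: X_def)
    then show ?thesis using R_eq by simp
  qed
  moreover have "(\<lambda>j. c j 0) ` {..<n} = X ` {..<n}" using c0 by auto
  ultimately have A0: "A 0 = ?m R" by (simp add: A_def)
  have "\<forall>\<^sub>F t in at 0. \<forall>j\<in>{..<n}. ?m (cball (c j t) 1 \<inter> outer j) \<le> ?m (cball (X j) 1 \<inter> outer j) + g j t"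
    using g(1) by (intro eventually_ball_finite) auto
  then have "\<forall>\<^sub>F t in at 0. G 0 \<le> G t"
  proof eventually_elim
    case (elim t)
    have "A t \<le> ?m inner_polygon + (\<Sum>j<n. ?m (cball (c j t) 1 \<inter> outer j))"
      unfolding A_def by (rule area_disk_intersection_le)
    also have "\<dots> \<le> ?m inner_polygon + (\<Sum>j<n. ?m (cball (X j) 1 \<inter> outer j) + g j t)"
      using elim by (intro add_left_mono sum_mono) auto
    also have "\<dots> \<le> A 0 + (\<Sum>j<n. g j t)" using area_R_ge A0 by (simp add: sum.distrib)
    finally show ?case using g(2) by (simp add: G_def)
  qed
  then obtain d where d: "d > 0" "\<And>t. t \<noteq> 0 \<Longrightarrow> dist t 0 < d \<Longrightarrow> G 0 \<le> G t"
    unfolding eventually_at by blast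
  have "(G has_real_derivative (\<Sum>j<n. ?l j * (u j \<bullet> c' j)) - 0) (at 0)"
    unfolding G_def using A g(3) by (intro DERIV_diff DERIV_sum) (auto simp: A_def)
  then have "(\<Sum>j<n. ?l j * (u j \<bullet> c' j)) - 0 = 0"
    by (rule DERIV_local_min[OF _ d(1)]) (metis d(2) dist_norm dist_commute real_norm_def order_refl)
  \<comment> \<open>Multiplying \<open>u j\<close> by the chord length undoes its normalization and
    leaves minus the quarter turn of the chord vector.\<close>
  moreover have "?l j * (u j \<bullet> c' j) = cross (c' j) (X (j + (k + 1)) - X (j + k))" for j
    using chord_pos[of j] by (simp add: u_def cross_def inner_2 algebra_simps)
  ultimately show ?thesis by simp
qed

end

subsection \<open>Intersection points of moving circles\<close>

lemma unit_curve_orthogonal: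
  fixes f :: "real \<Rightarrow> 'a::real_inner"
  assumes "(f has_vector_derivative f') (at 0)" "\<forall>\<^sub>F t in nhds 0. norm (f t) = 1"
  shows "f' \<bullet> f 0 = 0"
proof -
  have "((\<lambda>t. f t \<bullet> f t) has_derivative (\<lambda>t. f 0 \<bullet> (t *\<^sub>R f') + (t *\<^sub>R f') \<bullet> f 0)) (at 0)"
    using assms(1) unfolding has_vector_derivative_def by (intro has_derivative_inner)
  then have "((\<lambda>t. f t \<bullet> f t) has_real_derivative 2 * (f' \<bullet> f 0)) (at 0)"
    by (rule has_derivative_imp_has_field_derivative) (simp add: inner_commute)
  moreover have "\<forall>\<^sub>F t in nhds 0. f t \<bullet> f t = 1"
    using assms(2) by eventually_elim (simp add: norm_eq_1)
  then have "((\<lambda>t. f t \<bullet> f t) has_real_derivative 0) (at 0)"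
    by (subst DERIV_cong_ev[OF refl _ refl, of _ "\<lambda>_. 1"]) auto
  ultimately show ?thesis by (auto dest: DERIV_unique)
qed

text \<open>Criticality quantifies over all branches, so one must be exhibited, with a derivative.
  The two orthogonality relations express that \<open>y t\<close> keeps distance 1 from the fixed
  centre \<open>b\<close> and from the centre moving with velocity \<open>v\<close>.\<close>

lemma intersection_branch_exists:
  fixes a b v y0 :: "real^2"
  assumes "dist y0 a = 1" "dist y0 b = 1" "a \<noteq> b" "dist a b \<le> 1"
  obtains y y' where "intersection_branch a v b y0 y" "(y has_vector_derivative y') (at 0)"
    "y' \<bullet> (y0 - b) = 0" "(y' - v) \<bullet> (y0 - a) = 0"
proof -
  define W where "W t = a - b + t *\<^sub>R v" for t :: real
  define s where "s t = sqrt (1 / (W t \<bullet> W t) - 1 / 4)" for t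
  have w0: "W 0 = a - b" by (simp add: W_def)
  obtain \<sigma> where \<sigma>: "\<sigma> \<in> {1, - 1}" "y0 = b + (1/2) *\<^sub>R W 0 + (\<sigma> * s 0) *\<^sub>R perp (W 0)"
    using two_circles_point[OF assms(1-3)] unfolding s_def w0 by blast
  then have \<sigma>2: "\<sigma> * \<sigma> = 1" by auto
  define y where "y t = b + (1/2) *\<^sub>R W t + (\<sigma> * s t) *\<^sub>R (perp (a - b) + t *\<^sub>R perp v)" for t
  have perpW: "perp (W t) = perp (a - b) + t *\<^sub>R perp v" for t
    by (simp add: W_def vec_eq_2 algebra_simps)
  have y0: "y 0 = y0" using \<sigma> by (simp add: y_def perpW)
  have contW: "continuous_on S (\<lambda>t. W t \<bullet> W t)" for S unfolding W_def by (intro continuous_intros)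
  \<comment> \<open>The circles meet transversally in two points when the squared distance of their
    centres is strictly between 0 and 4. This open condition keeps the radicand of \<open>s\<close>
    positive near time 0, so \<open>s\<close> is differentiable there.\<close>
  have "W 0 \<bullet> W 0 \<le> 1"
    using assms(4) by (simp add: W_def dist_norm dot_square_norm abs_square_le_1)
  then have W0: "W 0 \<bullet> W 0 \<in> {0<..<4}" using assms(3) by (simp add: W_def)
  have "open ((\<lambda>t. W t \<bullet> W t) -` {0<..<4})"
    by (rule open_vimage[OF _ contW]) simp
  moreover have "0 \<in> (\<lambda>t. W t \<bullet> W t) -` {0<..<4}" using W0 by simp
  ultimately obtain d where d: "d > 0" "ball 0 d \<subseteq> (\<lambda>t. W t \<bullet> W t) -` {0<..<4}"
    by (rule openE)
  have Wd: "W t \<bullet> W t > 0" "W t \<bullet> W t < 4" if "t \<in> {-d<..<d}" for t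
    using d(2) that by (auto simp: subset_iff dist_real_def)
  have on: "norm (y t - b) = 1" "norm (y t - (a + t *\<^sub>R v)) = 1" if t: "t \<in> {-d<..<d}" for t
  proof -
    have "s t * s t = 1 / (W t \<bullet> W t) - 1 / 4"
      using Wd[OF t] by (simp add: s_def field_simps)
    then have *: "(W t \<bullet> W t) * (1/4 + (\<sigma> * s t) * (\<sigma> * s t)) = 1"
      using Wd[OF t] \<sigma>2 by (simp add: field_simps) (metis mult.assoc mult.left_commute mult_1)
    have eq: "(\<epsilon> *\<^sub>R W t + r *\<^sub>R perp (W t)) \<bullet> (\<epsilon> *\<^sub>R W t + r *\<^sub>R perp (W t)) = (W t \<bullet> W t) * (\<epsilon> * \<epsilon> + r * r)" for \<epsilon> r
      by (simp add: inner_2 algebra_simps)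
    have "y t - b = (1/2) *\<^sub>R W t + (\<sigma> * s t) *\<^sub>R perp (W t)" by (simp add: y_def perpW)
    then show "norm (y t - b) = 1" using * by (simp add: norm_eq_1 eq)
    have "y t - (a + t *\<^sub>R v) = (y t - b) - W t" by (simp add: W_def)
    also have "\<dots> = (-1/2) *\<^sub>R W t + (\<sigma> * s t) *\<^sub>R perp (W t)"
      by (simp add: y_def perpW vec_eq_2)
    finally have "y t - (a + t *\<^sub>R v) = (-1/2) *\<^sub>R W t + (\<sigma> * s t) *\<^sub>R perp (W t)" .
    then show "norm (y t - (a + t *\<^sub>R v)) = 1" unfolding norm_eq_1 using * by (simp only: eq) simp
  qed
  have "continuous_on {-d<..<d} y"
    unfolding y_def s_def W_def using Wd by (intro continuous_intros) (force simp: W_def)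
  then have branch: "intersection_branch a v b y0 y"
    unfolding intersection_branch_def using y0 d(1) on
    by (auto simp: dist_norm norm_minus_commute intro!: exI[of _ d])
  have W': "(W has_vector_derivative v) (at 0)"
    unfolding W_def by (auto intro!: derivative_eq_intros)
  have "((\<lambda>t. W t \<bullet> W t) has_derivative (\<lambda>t. W 0 \<bullet> (t *\<^sub>R v) + (t *\<^sub>R v) \<bullet> W 0)) (at 0)"
    using W' unfolding has_vector_derivative_def by (intro has_derivative_inner)
  then have WW': "((\<lambda>t. W t \<bullet> W t) has_real_derivative 2 * (v \<bullet> W 0)) (at 0)"
    by (rule has_derivative_imp_has_field_derivative) (simp add: inner_commute)
  have "1 / (W 0 \<bullet> W 0) - 1 / 4 > 0" using W0 by (simp add: field_simps)
  then have "\<exists>s'. (s has_real_derivative s') (at 0)"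
    unfolding s_def using W0 by (intro exI) (rule derivative_eq_intros WW' refl | simp)+
  then obtain s' where "(s has_real_derivative s') (at 0)" ..
  then have s': "((\<lambda>t. \<sigma> * s t) has_real_derivative \<sigma> * s') (at 0)" by (rule DERIV_cmult)
  have p': "((\<lambda>t. perp (a - b) + t *\<^sub>R perp v) has_vector_derivative perp v) (at 0)"
    by (auto intro!: derivative_eq_intros)
  have W2': "((\<lambda>t. b + (1/2) *\<^sub>R W t) has_vector_derivative (1/2) *\<^sub>R v) (at 0)"
    using has_vector_derivative_add[OF has_vector_derivative_const
        bounded_linear.has_vector_derivative[OF bounded_linear_scaleR_right W', of "1/2"]] by simp
  have "\<exists>y'. (y has_vector_derivative y') (at 0)"
    using has_vector_derivative_add[OF W2' has_vector_derivative_scaleR[OF s' p']]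
    unfolding y_def[abs_def] by blast
  then obtain y' where y': "(y has_vector_derivative y') (at 0)" ..
  have ev: "\<forall>\<^sub>F t in nhds 0. t \<in> {-d<..<d}" using d(1) by (intro eventually_nhds_in_open) auto
  have "y' \<bullet> (y 0 - b) = 0"
  proof (rule unit_curve_orthogonal)
    show "((\<lambda>t. y t - b) has_vector_derivative y') (at 0)"
      using y' by (auto intro!: derivative_eq_intros)
    show "\<forall>\<^sub>F t in nhds 0. norm (y t - b) = 1"
      using ev by eventually_elim (rule on)
  qed
  moreover have "(y' - v) \<bullet> (y 0 - (a + 0 *\<^sub>R v)) = 0"
  proof (rule unit_curve_orthogonal)
    show "((\<lambda>t. y t - (a + t *\<^sub>R v)) has_vector_derivative y' - v) (at 0)"
      using y' by (auto intro!: derivative_eq_intros)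
    show "\<forall>\<^sub>F t in nhds 0. norm (y t - (a + t *\<^sub>R v)) = 1"
      using ev by eventually_elim (rule on)
  qed
  ultimately show ?thesis using that[OF branch y'] y0 by simp
qed

subsection \<open>Equality of the angles\<close>

lemma cross_add_left: "cross (a + b) c = cross a c + cross b c"
  by (simp add: cross_def algebra_simps)

lemma cross_zero_left [simp]: "cross 0 c = 0"
  by (simp add: cross_def)

lemma cross_perp: "cross (perp a) b = - (a \<bullet> b)"
  by (simp add: cross_def inner_2)

lemma perp_inner: "perp a \<bullet> b = cross a b"
  by (simp add: cross_def inner_2)

lemma zero_if_orthogonal:
  assumes "w \<bullet> e = 0" "w \<bullet> f = 0" "cross e f \<noteq> 0"
  shows "w = 0"
proof -
  have "w \<bullet> w = 0"
    by (subst (2) cross_expand[OF assms(3)]) (simp add: inner_add_right assms)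
  then show ?thesis by simp
qed

lemma cross_square_inner_square:
  assumes "norm e = 1" "norm f = 1"
  shows "(cross e f)\<^sup>2 + (e \<bullet> f)\<^sup>2 = 1"
proof -
  have "e$1 * e$1 + e$2 * e$2 = 1" "f$1 * f$1 + f$2 * f$2 = 1"
    using assms unfolding norm_eq_1 inner_2 by auto
  then have "(e$1 * e$1 + e$2 * e$2) * (f$1 * f$1 + f$2 * f$2) = 1" by simp
  then show ?thesis by (simp add: cross_def inner_2 power2_eq_square algebra_simps)
qed

text \<open>The hypothesis says that the half-angle tangents \<open>(1 - cos) / sin\<close> agree.\<close>

lemma equal_half_angle:
  fixes c c' s s' :: real
  assumes "s > 0" "s' > 0" "s\<^sup>2 + c\<^sup>2 = 1" "s'\<^sup>2 + c'\<^sup>2 = 1" "(1 - c) * s' = s * (1 - c')"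
  shows "c = c'" "s = s'"
proof -
  have c: "c < 1" "c' < 1"
  proof -
    have "c\<^sup>2 < 1\<^sup>2" "c'\<^sup>2 < 1\<^sup>2" using assms(1-4) by (simp_all add: power2_eq_square) (smt (verit) mult_pos_pos)+
    then show "c < 1" "c' < 1" by (auto intro: power2_less_imp_less)
  qed
  \<comment> \<open>Squaring replaces the sines by cosines; the positive factor
    \<open>(1 - c) * (1 - c')\<close> can then be cancelled.\<close>
  have "((1 - c) * s')\<^sup>2 = (s * (1 - c'))\<^sup>2" using assms(5) by simp
  then have "(1 - c)\<^sup>2 * (1 - c'\<^sup>2) = (1 - c\<^sup>2) * (1 - c')\<^sup>2"
  proof -
    have "s'\<^sup>2 = 1 - c'\<^sup>2" "s\<^sup>2 = 1 - c\<^sup>2" using assms(3,4) by linarith+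
    then show ?thesis
      using \<open>((1 - c) * s')\<^sup>2 = (s * (1 - c'))\<^sup>2\<close> by (simp only: power_mult_distrib)
  qed
  then have "(1 - c) * (1 - c') * ((1 - c) * (1 + c')) = (1 - c) * (1 - c') * ((1 + c) * (1 - c'))"
    by (simp add: power2_eq_square algebra_simps)
  then have "(1 - c) * (1 + c') = (1 + c) * (1 - c')" using c by simp
  then show "c = c'" by (simp add: algebra_simps)
  then show "s = s'" using assms(5) c by simp
qed

context reuleaux_ccw begin

lemma X_cong: "i mod n = j mod n \<Longrightarrow> X i = X j"
  by (simp add: X_def)

text \<open>As \<open>n = 2 * k + 1\<close>, two steps of \<open>k\<close> go back by one vertex,
  written \<open>n - 1\<close> to stay in the naturals, and two steps of \<open>k + 1\<close> go
  forward by one.\<close>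

lemma X_shift: "X (i + k + k) = X (i + (n - 1))" "X (i + k + (k + 1)) = X i"
    "X (i + (k + 1) + k) = X i" "X (i + (k + 1) + (k + 1)) = X (i + 1)"
proof -
  have "i + k + k = i + (n - 1)" "i + k + (k + 1) = i + n" "i + (k + 1) + k = i + n"
    "i + (k + 1) + (k + 1) = i + 1 + n"
    using n(2) by linarith+
  then show "X (i + k + k) = X (i + (n - 1))" "X (i + k + (k + 1)) = X i"
    "X (i + (k + 1) + k) = X i" "X (i + (k + 1) + (k + 1)) = X (i + 1)"
    by (simp_all only: X_add_n)
qed

text \<open>\<open>w\<close> and \<open>w'\<close> are the velocities of the dependent vertices
  \<open>X (i + k)\<close> and \<open>X (i + (k + 1))\<close>. All other centres except
  \<open>X i\<close> rest, so the variation has three terms, each a velocity against the chord of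
  the arc about the moving centre.\<close>

lemma area_critical_variation:
  assumes "i < n" "norm v = 1"
    and crit: "\<And>y z. intersection_branch (x i) v (x ((i + n - 1) mod n)) (x ((i + k) mod n)) y \<Longrightarrow>
        intersection_branch (x i) v (x ((i + 1) mod n)) (x ((i + k + 1) mod n)) z \<Longrightarrow>
        ((\<lambda>t. measure lebesgue (perturbation k x i v y z t)) has_real_derivative 0) (at 0)"
  obtains w w' where
    "w \<bullet> (X (i + k) - X (i + (n - 1))) = 0" "(w - v) \<bullet> e i = 0"
    "w' \<bullet> (X (i + (k + 1)) - X (i + 1)) = 0" "(w' - v) \<bullet> f i = 0"
    "cross v (X (i + (k + 1)) - X (i + k)) + cross w (X i - X (i + (n - 1))) + cross w' (X (i + 1) - X i) = 0"
proof -
  have xX: "x i = X i" "x ((i + n - 1) mod n) = X (i + (n - 1))" "x ((i + k) mod n) = X (i + k)"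
    "x ((i + 1) mod n) = X (i + 1)" "x ((i + k + 1) mod n) = X (i + (k + 1))"
    using assms(1) n_pos by (simp_all add: X_def)
  have ne: "X i \<noteq> X (i + (n - 1))" "X i \<noteq> X (i + 1)"
  proof -
    have "1 < n - 1" "n - 1 < n" using n(3) by linarith+
    then have "orient (X i) (X (i + 1)) (X (i + (n - 1))) > 0" by (intro orient_X_pos) auto
    then show "X i \<noteq> X (i + (n - 1))" "X i \<noteq> X (i + 1)" unfolding orient_def by auto
  qed
  have d: "dist (X (i + k)) (X i) = 1" "dist (X (i + (k + 1))) (X i) = 1"
    using dist_X_k[of i] by (simp_all add: dist_commute)
  have d': "dist (X (i + k)) (X (i + (n - 1))) = 1" "dist (X (i + (k + 1))) (X (i + 1)) = 1"
    using dist_X_k(1)[of "i + k"] dist_X_k(2)[of "i + (k + 1)"] unfolding X_shift by blast+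
  obtain y w where y: "intersection_branch (X i) v (X (i + (n - 1))) (X (i + k)) y"
      "(y has_vector_derivative w) (at 0)"
      "w \<bullet> (X (i + k) - X (i + (n - 1))) = 0" "(w - v) \<bullet> (X (i + k) - X i) = 0"
    using intersection_branch_exists[OF d(1) d'(1) ne(1) dist_X_le] .
  obtain z w' where z: "intersection_branch (X i) v (X (i + 1)) (X (i + (k + 1))) z"
      "(z has_vector_derivative w') (at 0)"
      "w' \<bullet> (X (i + (k + 1)) - X (i + 1)) = 0" "(w' - v) \<bullet> (X (i + (k + 1)) - X i) = 0"
    using intersection_branch_exists[OF d(2) d'(2) ne(2) dist_X_le] .
  define p where "p = (i + k) mod n"
  define q where "q = (i + k + 1) mod n"
  define c where "c j t = (x(i := x i + t *\<^sub>R v, p := y t, q := z t)) j" for j t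
  \<comment> \<open>Written as a sum of indicators, the velocity splits the variation into three
    sums with one nonzero term each.\<close>
  define c' where "c' j = (if j = i then v else 0) + (if j = p then w else 0) + (if j = q then w' else 0)" for j
  have pq: "p < n" "q < n" using n_pos by (auto simp: p_def q_def)
  have Xpq: "X p = X (i + k)" "X q = X (i + (k + 1))" by (auto simp: p_def q_def X_eq_iff)
  have "X i \<noteq> X (i + k)" "X i \<noteq> X (i + (k + 1))" "X (i + k) \<noteq> X (i + (k + 1))"
    using d chord_pos[of i] by auto
  then have dist3: "i \<noteq> p" "i \<noteq> q" "p \<noteq> q" using Xpq by auto
  have "(\<Sum>j<n. cross (c' j) (X (j + (k + 1)) - X (j + k))) = 0"
  proof (rule area_first_variation)
    show "c j 0 = X j" if "j < n" for j
      using y(1) z(1) that Xpq by (auto simp: c_def intersection_branch_def X_def)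
    show "(c j has_vector_derivative c' j) (at 0)" if "j < n" for j
    proof -
      consider "j = i" | "j = p" | "j = q" | "j \<noteq> i" "j \<noteq> p" "j \<noteq> q" by blast
      then show ?thesis
      proof cases
        case 1
        then have "c j = (\<lambda>t. x i + t *\<^sub>R v)" "c' j = v" using dist3 by (auto simp: c_def c'_def)
        then show ?thesis by (auto intro!: derivative_eq_intros)
      next
        case 2
        then have "c j = y" "c' j = w" using dist3 by (auto simp: c_def c'_def)
        then show ?thesis using y(2) by simp
      next
        case 3
        then have "c j = z" "c' j = w'" using dist3 by (auto simp: c_def c'_def)
        then show ?thesis using z(2) by simp
      next
        case 4
        then have "c j = (\<lambda>t. x j)" "c' j = 0" by (auto simp: c_def c'_def)
        then show ?thesis by simp
      qed
    qed
    have "perturbation k x i v y z t = disk_intersection ((\<lambda>j. c j t) ` {..<n})" for t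
      by (simp add: perturbation_def Let_def c_def p_def q_def n(2))
    then show "((\<lambda>t. measure lebesgue (disk_intersection ((\<lambda>j. c j t) ` {..<n}))) has_real_derivative 0) (at 0)"
      using crit[of y z] y(1) z(1) xX by simp
  qed
  also have "(\<Sum>j<n. cross (c' j) (X (j + (k + 1)) - X (j + k)))
      = (\<Sum>j<n. if j = i then cross v (X (j + (k + 1)) - X (j + k)) else 0)
      + (\<Sum>j<n. if j = p then cross w (X (j + (k + 1)) - X (j + k)) else 0)
      + (\<Sum>j<n. if j = q then cross w' (X (j + (k + 1)) - X (j + k)) else 0)"
    unfolding sum.distrib[symmetric] by (intro sum.cong refl) (simp add: c'_def cross_add_left)
  also have "\<dots> = cross v (X (i + (k + 1)) - X (i + k)) + cross w (X (p + (k + 1)) - X (p + k))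
      + cross w' (X (q + (k + 1)) - X (q + k))"
    using assms(1) pq by (simp add: sum.delta)
  also have "X (p + (k + 1)) = X i"
    using X_shift(2)[of i] X_cong[of "p + (k + 1)" "i + k + (k + 1)"] by (simp only: p_def mod_add_left_eq)
  also have "X (p + k) = X (i + (n - 1))"
    using X_shift(1)[of i] X_cong[of "p + k" "i + k + k"] by (simp only: p_def mod_add_left_eq)
  also have "X (q + (k + 1)) = X (i + 1)"
    using X_shift(4)[of i] X_cong[of "q + (k + 1)" "i + (k + 1) + (k + 1)"]
    by (simp only: q_def mod_add_left_eq add.assoc)
  also have "X (q + k) = X i"
    using X_shift(3)[of i] X_cong[of "q + k" "i + (k + 1) + k"]
    by (simp only: q_def mod_add_left_eq add.assoc)
  finally show ?thesis using that y z by blast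
qed

definition critical :: bool where
  "critical \<longleftrightarrow> (\<forall>i<n. \<forall>v y z. norm v = 1 \<longrightarrow>
    intersection_branch (x i) v (x ((i + n - 1) mod n)) (x ((i + k) mod n)) y \<longrightarrow>
    intersection_branch (x i) v (x ((i + 1) mod n)) (x ((i + k + 1) mod n)) z \<longrightarrow>
    ((\<lambda>t. measure lebesgue (perturbation k x i v y z t)) has_real_derivative 0) (at 0))"

text \<open>Moving \<open>X i\<close> orthogonally to \<open>f i\<close> leaves \<open>X (i + k + 1)\<close> fixed to first order, so that the
  variation only compares the angles at \<open>X i\<close> and \<open>X (i + k)\<close>.\<close>

lemma critical_angle_step:
  assumes critical "i < n"
  shows "e (i + k) \<bullet> f (i + k) = e i \<bullet> f i" "cross (e (i + k)) (f (i + k)) = cross (e i) (f i)"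
proof -
  define v where "v = perp (f i)"
  have nf: "norm (f i) = 1" "norm (e i) = 1" by auto
  have v: "norm v = 1" using nf by (simp add: v_def)
  obtain w w' where w: "w \<bullet> (X (i + k) - X (i + (n - 1))) = 0" "(w - v) \<bullet> e i = 0"
    "w' \<bullet> (X (i + (k + 1)) - X (i + 1)) = 0" "(w' - v) \<bullet> f i = 0"
    "cross v (X (i + (k + 1)) - X (i + k)) + cross w (X i - X (i + (n - 1))) + cross w' (X (i + 1) - X i) = 0"
    by (rule area_critical_variation[OF assms(2) v]) (use assms v in \<open>auto simp: critical_def\<close>)
  define E where "E = e i" define F where "F = f i"
  define E' where "E' = X (i + k) - X (i + (n - 1))"
  \<comment> \<open>The edge \<open>E\<close> is shared by the angles at \<open>X i\<close> and
    \<open>X (i + k)\<close>: the first lies between \<open>E\<close> and \<open>F\<close>, the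
    second between \<open>E'\<close> and \<open>E\<close> after reversing both vectors.\<close>
  have sE': "e (i + k) = - E'" "f (i + k) = - E"
    unfolding X_shift E'_def E_def by simp_all
  have nE': "norm E' = 1" using norm_ef(1)[of "i + k"] unfolding sE' by simp
  have S: "cross E' E > 0" using cross_ef_pos[of "i + k"] unfolding sE' by (simp add: cross_def)
  have T: "cross E F > 0" using cross_ef_pos[of i] by (simp add: E_def F_def)
  \<comment> \<open>As \<open>v\<close> is orthogonal to \<open>f i\<close>, the velocity
    \<open>w'\<close> is orthogonal to both radii at \<open>X (i + (k + 1))\<close>, and these are
    linearly independent.\<close>
  have "w' = 0"
  proof (rule zero_if_orthogonal)
    show "w' \<bullet> f i = 0" using w(4) by (simp add: v_def inner_diff_left perp_inner cross_def)
    show "w' \<bullet> (X (i + (k + 1)) - X (i + 1)) = 0" by (rule w(3))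
    show "cross (f i) (X (i + (k + 1)) - X (i + 1)) \<noteq> 0"
      using cross_ef_pos[of "i + (k + 1)"] unfolding X_shift by (simp add: cross_def algebra_simps)
  qed
  define s where "s = w \<bullet> perp E'"
  have "w = s *\<^sub>R perp E'"
    using expand_by_inner_perp[OF nE', of w] w(1) by (simp add: s_def E'_def)
  moreover have "w \<bullet> E = - cross E F"
    using w(2) by (simp add: inner_diff_left v_def perp_inner E_def F_def cross_def)
  ultimately have s: "s * cross E' E = - cross E F" by (simp add: perp_inner)
  have "cross v (F - E) + cross w (E' - E) = 0"
    using w(5) \<open>w' = 0\<close> by (simp add: E_def F_def E'_def)
  moreover have "cross w (E' - E) = s * (E' \<bullet> E - 1)"
  proof -
    have "cross w (E' - E) = s * cross (perp E') (E' - E)"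
      unfolding \<open>w = s *\<^sub>R perp E'\<close> by (simp add: cross_def algebra_simps)
    also have "cross (perp E') (E' - E) = E' \<bullet> E - 1"
      using nE' unfolding cross_perp norm_eq_1 by (simp add: inner_diff_right)
    finally show ?thesis .
  qed
  moreover have "cross v (F - E) = E \<bullet> F - 1"
    using nf(1) unfolding v_def cross_perp norm_eq_1 F_def[symmetric]
    by (simp add: inner_diff_right inner_commute)
  ultimately have "(1 - E \<bullet> F) = s * (E' \<bullet> E - 1)" by simp
  then have "(1 - E \<bullet> F) * cross E' E = s * cross E' E * (E' \<bullet> E - 1)" by simp
  also have "\<dots> = cross E F * (1 - E' \<bullet> E)" unfolding s by (simp add: algebra_simps)
  finally have eq: "(1 - E \<bullet> F) * cross E' E = cross E F * (1 - E' \<bullet> E)" .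
  have "E \<bullet> F = E' \<bullet> E" "cross E F = cross E' E"
    using equal_half_angle[OF T S cross_square_inner_square cross_square_inner_square eq] nE' nf
    by (auto simp: E_def F_def)
  moreover have "e (i + k) \<bullet> f (i + k) = E' \<bullet> E" "cross (e (i + k)) (f (i + k)) = cross E' E"
    unfolding sE' by (simp_all add: cross_def)
  ultimately show "e (i + k) \<bullet> f (i + k) = e i \<bullet> f i" "cross (e (i + k)) (f (i + k)) = cross (e i) (f i)"
    unfolding E_def F_def by simp_all
qed

text \<open>Iterating the previous step follows the star polygon from \<open>X 0\<close>. Indices
  are reduced modulo \<open>n\<close> only to apply that step, \<open>X\<close> being
  periodic.\<close>

lemma critical_angles:
  assumes critical
  shows "e (m * k) \<bullet> f (m * k) = e 0 \<bullet> f 0" "cross (e (m * k)) (f (m * k)) = cross (e 0) (f 0)"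
proof (induction m)
  case (Suc m)
  define i where "i = (m * k) mod n"
  have X: "X (i + c) = X (m * k + c)" for c by (simp add: X_eq_iff i_def mod_add_left_eq)
  have X0: "X i = X (m * k)" using X[of 0] by simp
  have i: "i < n" using n_pos by (simp add: i_def)
  have Xk: "X (i + k + c) = X (Suc m * k + c)" for c using X[of "k + c"] by (simp add: ac_simps)
  have Xk0: "X (i + k) = X (Suc m * k)" using Xk[of 0] by simp
  { case 1
    have "e (Suc m * k) \<bullet> f (Suc m * k) = e i \<bullet> f i"
      using critical_angle_step(1)[OF assms i] by (simp only: Xk Xk0)
    also have "\<dots> = e (m * k) \<bullet> f (m * k)" by (simp only: X X0)
    finally show ?case using Suc.IH(1) by (rule trans)
  next
    case 2
    have "cross (e (Suc m * k)) (f (Suc m * k)) = cross (e i) (f i)"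
      using critical_angle_step(2)[OF assms i] by (simp only: Xk Xk0)
    also have "\<dots> = cross (e (m * k)) (f (m * k))" by (simp only: X X0)
    finally show ?case using Suc.IH(2) by (rule trans) }
qed auto

end

subsection \<open>Equal angles force regularity\<close>

definition to_complex :: "real^2 \<Rightarrow> complex" where
  "to_complex p = Complex (p$1) (p$2)"

lemma to_complex_simps:
  "to_complex (p - q) = to_complex p - to_complex q"
  "to_complex p = to_complex q \<longleftrightarrow> p = q"
  by (simp_all add: to_complex_def complex_eq_iff vec_eq_2)

lemma to_complex_rotation:
  assumes "norm a = 1"
  shows "to_complex b = Complex (a \<bullet> b) (cross a b) * to_complex a"
proof -
  have 1: "a$1 * a$1 + a$2 * a$2 = 1" using assms by (simp add: norm_eq_1 inner_2)
  have "b$1 * (a$1 * a$1 + a$2 * a$2) = b$1" "b$2 * (a$1 * a$1 + a$2 * a$2) = b$2"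
    unfolding 1 by simp_all
  then show ?thesis by (simp add: to_complex_def complex_eq_iff inner_2 cross_def algebra_simps)
qed

text \<open>The differences form a geometric sequence, so the points are the orbit of an affine map
  with linear part \<omega>. Its fixed point, which exists as \<omega> is not 1, is the constant
  term.\<close>

lemma geometric_sequence_closed_form:
  fixes y :: "nat \<Rightarrow> 'a::field"
  assumes "\<And>m. y (Suc (Suc m)) - y (Suc m) = \<omega> * (y (Suc m) - y m)" "\<omega> \<noteq> 1"
  shows "y m = (y 0 - (y 1 - y 0) / (\<omega> - 1)) + (y 1 - y 0) / (\<omega> - 1) * \<omega> ^ m"
proof -
  have step: "y (Suc m) - y m = (y 1 - y 0) * \<omega> ^ m" for m
    by (induction m) (auto simp: assms(1))
  have r: "(y 1 - y 0) / (\<omega> - 1) * \<omega> ^ Suc m = (y 1 - y 0) / (\<omega> - 1) * \<omega> ^ m + (y 1 - y 0) * \<omega> ^ m" for m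
  proof -
    have "(y 1 - y 0) / (\<omega> - 1) * \<omega> ^ Suc m - (y 1 - y 0) / (\<omega> - 1) * \<omega> ^ m
        = ((y 1 - y 0) / (\<omega> - 1) * (\<omega> - 1)) * \<omega> ^ m"
      by (simp only: power_Suc right_diff_distrib left_diff_distrib mult.assoc mult_1_right mult_1_left)
    also have "(y 1 - y 0) / (\<omega> - 1) * (\<omega> - 1) = y 1 - y 0" using assms(2) by simp
    finally show ?thesis by (simp add: algebra_simps)
  qed
  show ?thesis
  proof (induction m)
    case (Suc m)
    have "y (Suc m) = y m + (y 1 - y 0) * \<omega> ^ m" using step[of m] by (simp add: algebra_simps)
    then show ?case unfolding r using Suc.IH by (simp add: add.assoc)
  qed simp
qed

text \<open>There are only \<open>n\<close> roots of unity of order dividing \<open>n\<close>, so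
  \<open>n\<close> distinct ones exhaust them. Which primitive root \<eta> is need not be
  determined.\<close>

lemma powers_eq_roots_unity:
  fixes \<eta> :: complex
  assumes "n > 0" "\<eta> ^ n = 1" "inj_on (\<lambda>j. \<eta> ^ j) {..<n}"
  shows "(\<lambda>j. \<eta> ^ j) ` {..<n} = (\<lambda>j. cis (2 * pi * real j / real n)) ` {..<n}"
proof -
  have r: "(\<lambda>j. cis (2 * pi * real j / real n)) ` {..<n} = {z. z ^ n = 1}"
    using Complex.bij_betw_roots_unity[OF assms(1)] by (simp add: bij_betw_def)
  have "(\<lambda>j. \<eta> ^ j) ` {..<n} \<subseteq> {z. z ^ n = 1}"
    using assms(2) by (auto simp: power_mult[symmetric] mult.commute[of _ n]) (simp add: power_mult)
  moreover have "card ((\<lambda>j. \<eta> ^ j) ` {..<n}) = card {z :: complex. z ^ n = 1}"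
    using assms by (simp add: card_image Complex.card_roots_unity_eq)
  ultimately show ?thesis
    unfolding r using assms(1) by (intro card_subset_eq finite_roots_unity) auto
qed

context reuleaux_ccw begin

lemma critical_regular:
  assumes critical
  shows "regular_reuleaux_polygon n R"
proof -
  define C where "C = e 0 \<bullet> f 0"
  define S where "S = cross (e 0) (f 0)"
  have S: "S > 0" unfolding S_def by (rule cross_ef_pos)
  have CS: "S\<^sup>2 + C\<^sup>2 = 1"
    unfolding C_def S_def by (rule cross_square_inner_square) (use norm_ef[of 0] in auto)
  define y where "y m = to_complex (X (m * k))" for m
  \<comment> \<open>If \<alpha> is the common interior angle, consecutive edges of the star polygon
    turn by \<pi> - \<alpha>, whose cosine and sine are \<open>- C\<close> and
    \<open>S\<close>.\<close>
  define \<omega> where "\<omega> = Complex (- C) S"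
  have idx: "X (Suc m * k) = X (m * k + k)" "X (Suc (Suc m) * k) = X (m * k + k + k)" for m
    by (simp_all add: ac_simps)
  have step: "y (Suc (Suc m)) - y (Suc m) = \<omega> * (y (Suc m) - y m)" for m
  proof -
    let ?i = "Suc m * k"
    have ie: "?i + k = Suc (Suc m) * k" by simp
    have fi: "X (?i + (k + 1)) = X (m * k)"
      using X_shift(2)[of "m * k"] by (simp add: ac_simps)
    have ei: "e ?i = X (Suc (Suc m) * k) - X (Suc m * k)" by (simp only: ie)
    have "to_complex (f ?i) = Complex C S * to_complex (e ?i)"
      using to_complex_rotation[OF norm_ef(1)[of ?i], of "f ?i"] critical_angles[OF assms, of "Suc m"]
      by (simp only: C_def S_def)
    then have "y m - y (Suc m) = Complex C S * (y (Suc (Suc m)) - y (Suc m))"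
      unfolding fi ei by (simp only: to_complex_simps y_def)
    then have "\<omega> * (y (Suc m) - y m) = (- \<omega> * Complex C S) * (y (Suc (Suc m)) - y (Suc m))"
      by (simp only: mult.assoc) (metis minus_diff_eq mult_minus_left mult_minus_right)
    also have "- \<omega> * Complex C S = 1"
      using CS by (simp add: \<omega>_def complex_eq_iff power2_eq_square)
    finally show ?thesis by simp
  qed
  have "\<omega> \<noteq> 1" using S by (simp add: \<omega>_def complex_eq_iff)
  define \<rho> where "\<rho> = (y 1 - y 0) / (\<omega> - 1)"
  define z where "z = y 0 - \<rho>"
  have y_eq: "y m = z + \<rho> * \<omega> ^ m" for m
    unfolding z_def \<rho>_def by (rule geometric_sequence_closed_form[where y = y, OF step \<open>\<omega> \<noteq> 1\<close>])
  have "X k \<noteq> X 0" using norm_ef(1)[of 0] by auto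
  then have "y 1 \<noteq> y 0" by (simp add: y_def to_complex_simps)
  then have "\<rho> \<noteq> 0" using \<open>\<omega> \<noteq> 1\<close> by (simp add: \<rho>_def)
  have "X (n * k) = X 0" by (rule X_cong) simp
  then have "y n = y 0" by (simp add: y_def)
  then have \<omega>n: "\<omega> ^ n = 1" using y_eq[of n] y_eq[of 0] \<open>\<rho> \<noteq> 0\<close> by simp
  \<comment> \<open>\<open>n - 2\<close> is inverse to \<open>k\<close> modulo \<open>n\<close>:
    \<open>(n - 2) * k = (k - 1) * n + 1\<close>. So \<open>n - 2\<close> edges of the star polygon
    advance by one vertex in the counter-clockwise order.\<close>
  define \<eta> where "\<eta> = \<omega> ^ (n - 2)"
  have Xj: "to_complex (X j) = z + \<rho> * \<eta> ^ j" for j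
  proof -
    have "(n - 2) * k = (k - 1) * n + 1"
    proof -
      obtain l where l: "k = l + 1" using n_pos(2) by (metis add.commute le_add_diff_inverse one_le_numeral order_trans)
      then show ?thesis using n(2) by (simp add: algebra_simps)
    qed
    moreover have "(n - 2) * j * k = j * ((n - 2) * k)" by (simp only: ac_simps)
    ultimately have "(n - 2) * j * k = j + j * (k - 1) * n"
      by (simp only: add_mult_distrib2 mult_1_right mult.assoc add.commute)
    then have "X ((n - 2) * j * k) = X j" by (intro X_cong) simp
    then show ?thesis using y_eq[of "(n - 2) * j"] by (simp add: y_def \<eta>_def power_mult)
  qed
  have \<eta>n: "\<eta> ^ n = 1" by (metis \<eta>_def \<omega>n mult.commute power_mult power_one)
  have "inj_on (\<lambda>j. \<eta> ^ j) {..<n}"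
  proof (rule inj_onI)
    fix i j assume ij: "i \<in> {..<n}" "j \<in> {..<n}" "\<eta> ^ i = \<eta> ^ j"
    then have "to_complex (X i) = to_complex (X j)" by (simp add: Xj)
    then show "i = j" using ij by (simp add: to_complex_simps X_eq_iff)
  qed
  then have roots: "(\<lambda>j. \<eta> ^ j) ` {..<n} = (\<lambda>j. cis (2 * pi * real j / real n)) ` {..<n}"
    using powers_eq_roots_unity n_pos(1) \<eta>n by blast
  define r where "r = cmod \<rho>"
  define \<theta> where "\<theta> = Arg \<rho>"
  have \<rho>: "\<rho> = of_real r * cis \<theta>" "r > 0"
    using \<open>\<rho> \<noteq> 0\<close> by (simp_all add: r_def \<theta>_def rcis_cmod_Arg[unfolded rcis_def])
  define c :: "real^2" where "c = vector [Re z, Im z]"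
  have tc: "to_complex (c + r *\<^sub>R vector [cos (\<theta> + t), sin (\<theta> + t)]) = z + \<rho> * cis t" for t
    by (simp add: \<rho> cis_mult to_complex_def c_def complex_eq_iff cos_add sin_add algebra_simps)
  have "to_complex ` regular_ngon_vertices n c r \<theta> = (\<lambda>w. z + \<rho> * w) ` (\<lambda>j. cis (2 * pi * real j / real n)) ` {..<n}"
    unfolding regular_ngon_vertices_def image_image tc ..
  also have "\<dots> = to_complex ` X ` {..<n}"
    unfolding roots[symmetric] image_image Xj ..
  finally have V: "regular_ngon_vertices n c r \<theta> = X ` {..<n}"
    by (rule inj_image_eq_iff[THEN iffD1, rotated]) (simp add: inj_def to_complex_simps)
  have XR: "X ` {..<n} = range X" using vertices_eq vertices_range by (simp add: X_def)
  have "range X \<subseteq> R" by auto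
  then have hull: "convex hull (range X) \<subseteq> R" by (rule hull_minimal[where S = convex, OF _ convex_R])
  \<comment> \<open>The hull lies in \<open>R\<close>, whose points are at most 1 apart, and
    contains the diameter from \<open>X 0\<close> to \<open>X k\<close>.\<close>
  have "diameter (convex hull (range X)) = 1"
  proof (rule antisym)
    show "diameter (convex hull (range X)) \<le> 1"
      using hull constant_width_dist_le[OF constant_width]
      by (intro diameter_le) (auto simp: dist_norm subset_iff)
    have "bounded (convex hull (range X))" using hull bounded_R bounded_subset by blast
    then have "dist (X 0) (X (0 + k)) \<le> diameter (convex hull (range X))"
      by (rule diameter_bounded_bound) (auto intro: hull_inc)
    then show "1 \<le> diameter (convex hull (range X))" using dist_X_k(1)[of 0] by simp
  qed
  then show ?thesis
    unfolding regular_reuleaux_polygon_def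
    using V XR R_eq \<rho>(2) by metis
qed

end

theorem mainTheorem3:
  fixes R :: "(real^2) set" and n k :: nat
  assumes "reuleaux_polygon R"
    and "num_sides R = n"
    and "n = 2 * k + 1"
    and "n \<ge> 5"
    and "area_critical R"
  shows "regular_reuleaux_polygon n R"
proof -
  obtain k' x where x: "num_sides R = 2 * k' + 1" "ccw_labelling R x"
    "\<And>i v y z. i < num_sides R \<Longrightarrow> norm v = 1 \<Longrightarrow>
        intersection_branch (x i) v (x ((i + num_sides R - 1) mod num_sides R)) (x ((i + k') mod num_sides R)) y \<Longrightarrow>
        intersection_branch (x i) v (x ((i + 1) mod num_sides R)) (x ((i + k' + 1) mod num_sides R)) z \<Longrightarrow>
        ((\<lambda>t. measure lebesgue (perturbation k' x i v y z t)) has_real_derivative 0) (at 0)"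
    using assms(5) unfolding area_critical_def Let_def by blast
  have "k' = k" using x(1) assms(2,3) by simp
  interpret reuleaux_ccw R x n k
    using assms x(2) by unfold_locales
  have critical
    unfolding critical_def using x(3) assms(2) \<open>k' = k\<close> by simp
  then show ?thesis by (rule critical_regular)
qed

end
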